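(* Let $\mathbb{T}=[-\pi,\pi]$ with periodic boundary conditions. Let $\beta\in C^4([0,\infty))$ with $\beta\geq 0$, and let $\rho_0\in H^k(\mathbb{T})$ with $k\geq 2$ and $\rho_0\geq 0$. Let $\rho$ be a smooth solution of $$ \partial_t\rho=\partial_x\left(-\beta(\rho)H\rho+\rho\,\partial_x v\right),\qquad \partial_x^2 v=\rho-\langle\rho\rangle,\qquad x\in\mathbb{T},\ t>0, $$ with initial data $\rho(\cdot,0)=\rho_0$, and let $\tau$ be the maximum lifespan of $\rho$. Assume that $$ \lim_{y\to\infty}\beta(y)=\infty. $$ Then there is a finite constant $C(\rho_0,\beta)$, depending only on $\rho_0$ and $\beta$, such that $$ \|\rho(t)\|_{L^\infty(\mathbb{T})}\leq C(\rho_0,\beta)\qquad\text{for all } 0\leq t<\tau. $$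
   Context: $\mathbb{T}=[-\pi,\pi]$ is the one-dimensional torus; all functions of $x$ (including $v$) are $2\pi$-periodic. $\langle\rho\rangle=\frac{1}{2\pi}\int_{\mathbb{T}}\rho(x)\,dx$ is the spatial mean. $H$ is the periodic Hilbert transform $$H\rho(x)=\frac{1}{2\pi}\,\mathrm{P.V.}\int_{\mathbb{T}}\frac{\rho(y)}{\tan\left(\frac{x-y}{2}\right)}\,dy.$$ The function $v$ is determined by $\rho$ up to an additive constant, so $\partial_x v$ is uniquely determined. The solution meant is the classical solution with values in $H^k(\mathbb{T})$, continuous in time, with initial data $\rho_0$; for such data a unique solution in $C([0,t_0],H^k(\mathbb{T}))$ exists for some $t_0>0$, and its maximum lifespan $\tau\in(0,\infty]$ is the supremum of the times up to which it exists. *)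

theory Defs
  imports "HOL-Analysis.Analysis" "HOL-Probability.Essential_Supremum"
begin

text \<open>
  Functions on the torus are \<open>2\<pi>\<close>-periodic functions \<open>real \<Rightarrow> real\<close>;
  the fundamental domain is \<open>{-pi..pi}\<close>.
\<close>

definition periodic :: "(real \<Rightarrow> real) \<Rightarrow> bool" where
  "periodic f \<longleftrightarrow> (\<forall>x. f (x + 2 * pi) = f x)"

definition mean :: "(real \<Rightarrow> real) \<Rightarrow> real" where
  "mean f = 1 / (2 * pi) * integral {-pi..pi} f"

text \<open>
  The principal value removes the points at torus distance less than \<open>\<epsilon>\<close> from \<open>x\<close>.
  By periodicity the integral may be taken over the period centred at \<open>x\<close>, where
  the torus distance is \<open>\<bar>x - y\<bar>\<close>.
\<close>

definition hilbert :: "(real \<Rightarrow> real) \<Rightarrow> real \<Rightarrow> real" where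
  "hilbert f x = 1 / (2 * pi) *
     Lim (at_right 0) (\<lambda>\<epsilon>. integral ({x - pi..x - \<epsilon>} \<union> {x + \<epsilon>..x + pi})
                              (\<lambda>y. f y / tan ((x - y) / 2)))"

definition Linf_norm :: "(real \<Rightarrow> real) \<Rightarrow> ereal" where
  "Linf_norm f = esssup (lebesgue_on {-pi..pi}) (\<lambda>x. ereal \<bar>f x\<bar>)"

definition fourier_coeff :: "(real \<Rightarrow> real) \<Rightarrow> int \<Rightarrow> complex" where
  "fourier_coeff f n =
     1 / (2 * pi) * integral {-pi..pi} (\<lambda>x. complex_of_real (f x) * cis (- (of_int n * x)))"

definition Hk_weight :: "nat \<Rightarrow> (real \<Rightarrow> real) \<Rightarrow> int \<Rightarrow> real" where
  "Hk_weight k f n = (1 + (real_of_int n)\<^sup>2) ^ k * (cmod (fourier_coeff f n))\<^sup>2"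

text \<open>
  The Sobolev space \<open>H\<^sup>k\<close> of the torus for \<open>k \<ge> 1\<close>: every class then has exactly one
  continuous representative, and it is this representative that is meant.
\<close>

definition Hk :: "nat \<Rightarrow> (real \<Rightarrow> real) set" where
  "Hk k = {f. periodic f \<and> continuous_on UNIV f \<and> Hk_weight k f summable_on UNIV}"

definition Hk_norm :: "nat \<Rightarrow> (real \<Rightarrow> real) \<Rightarrow> real" where
  "Hk_norm k f = sqrt (\<Sum>\<^sub>\<infinity>n. Hk_weight k f n)"

definition continuous_in_Hk :: "nat \<Rightarrow> real set \<Rightarrow> (real \<Rightarrow> real \<Rightarrow> real) \<Rightarrow> bool" where
  "continuous_in_Hk k I \<rho> \<longleftrightarrow>
     (\<forall>t\<in>I. \<rho> t \<in> Hk k) \<and>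
     (\<forall>s\<in>I. ((\<lambda>t. Hk_norm k (\<lambda>x. \<rho> t x - \<rho> s x)) \<longlongrightarrow> 0) (at s within I))"

text \<open>Derivatives are taken within \<open>S\<close>, hence one-sided at a boundary point of an interval \<open>S\<close>.\<close>

definition C_on :: "nat \<Rightarrow> real set \<Rightarrow> (real \<Rightarrow> real) \<Rightarrow> bool" where
  "C_on m S f \<longleftrightarrow>
     (\<exists>D :: nat \<Rightarrow> real \<Rightarrow> real.
        (\<forall>y\<in>S. D 0 y = f y) \<and>
        (\<forall>i<m. \<forall>y\<in>S. (D i has_real_derivative D (Suc i) y) (at y within S)) \<and>
        continuous_on S (D m))"

definition is_potential :: "(real \<Rightarrow> real) \<Rightarrow> (real \<Rightarrow> real) \<Rightarrow> bool" where
  "is_potential f v \<longleftrightarrow>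
     periodic v \<and>
     (\<forall>x. v differentiable (at x)) \<and>
     (\<forall>x. (deriv v has_real_derivative (f x - mean f)) (at x))"

definition flux :: "(real \<Rightarrow> real) \<Rightarrow> (real \<Rightarrow> real) \<Rightarrow> (real \<Rightarrow> real) \<Rightarrow> real \<Rightarrow> real" where
  "flux \<beta> f v x = - \<beta> (f x) * hilbert f x + f x * deriv v x"

text \<open>
  Here \<open>\<rho> t x\<close> is the density at time \<open>t\<close> and position \<open>x\<close>, and \<open>I\<close> is a time interval
  starting at \<open>0\<close>. The mobility \<open>\<beta>\<close> is a function on \<open>[0,\<infinity>)\<close>, so that \<open>\<beta>(\<rho>)\<close> is defined only
  for \<open>\<rho> \<ge> 0\<close>; since Isabelle functions are total, this domain condition is stated explicitly.
\<close>

definition solution_on ::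
  "nat \<Rightarrow> (real \<Rightarrow> real) \<Rightarrow> (real \<Rightarrow> real) \<Rightarrow> real set \<Rightarrow> (real \<Rightarrow> real \<Rightarrow> real) \<Rightarrow> bool" where
  "solution_on k \<beta> \<rho>\<^sub>0 I \<rho> \<longleftrightarrow>
     continuous_in_Hk k I \<rho> \<and>
     (\<forall>t\<in>I. \<forall>x. 0 \<le> \<rho> t x) \<and>
     (0 \<in> I \<longrightarrow> \<rho> 0 = \<rho>\<^sub>0) \<and>
     (\<exists>v. (\<forall>t\<in>I. is_potential (\<rho> t) (v t)) \<and>
          (\<forall>t\<in>I. 0 < t \<longrightarrow>
             (\<forall>x. \<exists>d. ((\<lambda>s. \<rho> s x) has_real_derivative d) (at t within I) \<and>
                      (flux \<beta> (\<rho> t) (v t) has_real_derivative d) (at x))))"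

definition lifespan :: "nat \<Rightarrow> (real \<Rightarrow> real) \<Rightarrow> (real \<Rightarrow> real) \<Rightarrow> ereal" where
  "lifespan k \<beta> \<rho>\<^sub>0 = Sup {ereal T | T. 0 < T \<and> (\<exists>\<rho>. solution_on k \<beta> \<rho>\<^sub>0 {0..T} \<rho>)}"

end

(*
  Maximum principle. At a spatial maximum of rho(t), with value M, the flux derivative reduces to
  - beta(M) L + M (M - mean), where L = d/dx H rho is the half-Laplacian. Since rho >= 0 has conserved
  mass m, rho can be comparable to M only on a set of size m / M, and this forces
  L >= M^2 / (pi m). Hence once beta(M) > pi m the maximum strictly decreases, and such an M
  is a barrier, because beta tends to infinity.

  For k >= 2 the Fourier coefficients of rho(t) are absolutely summable with weight 1 + |n|, so
  f, H f and d/dx H f are given by uniformly convergent trigonometric series; comparing these with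
  their Poisson regularisations gives both Fourier inversion and the lower bound on L.
*)
theory Submission
  imports Defs
begin

text \<open>The threshold pi m comes from the kernel of the half-Laplacian, 1 / (4 pi sin^2(z/2)),
  which is at least 1 / (pi d^2) for |z| <= d. With d = m / M the integral of M - f over this ball
  is at least 2 d M - m = m, so L >= m / (pi d^2) = M^2 / (pi m). The singular kernel itself is
  avoided: the estimate is made with the bounded Poisson kernel for r < 1 and then passed to the
  limit. The equation gives time derivatives only at each fixed x and for t > 0. Hence the maximum
  is never differentiated as a function of time; the sign of the derivative is used at one point, at
  the first contact with the barrier. For the same reason conservation of mass takes work:
  differentiating under the integral needs a bound on the time derivative that is uniform in x and
  t, and this is read off from the equation on a compact time interval. The barrier is fixed by
  \<open>\<rho>\<^sub>0\<close> and \<beta> alone. The exponent k enters only through the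
  summability of Fourier coefficients.\<close>

section \<open>Absolutely convergent trigonometric series\<close>

lemma has_integral_series:
  fixes f :: "nat \<Rightarrow> real \<Rightarrow> real"
  assumes "\<And>n. (f n has_integral I n) {a..b}"
    and "\<And>n. continuous_on {a..b} (f n)"
    and "\<And>n x. x \<in> {a..b} \<Longrightarrow> \<bar>f n x\<bar> \<le> M n"
    and "summable M"
  shows "((\<lambda>x. \<Sum>n. f n x) has_integral (\<Sum>n. I n)) {a..b}"
    and "summable I"
proof -
  have u: "uniform_limit {a..b} (\<lambda>n x. \<Sum>i<n. f i x) (\<lambda>x. \<Sum>i. f i x) sequentially"
    using assms(3,4) by (intro Weierstrass_m_test) auto
  obtain J K where J: "\<And>n. ((\<lambda>x. \<Sum>i<n. f i x) has_integral J n) {a..b}"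
    and K: "((\<lambda>x. \<Sum>i. f i x) has_integral K) {a..b}" and JK: "J \<longlonglongrightarrow> K"
    using uniform_limit_integral[OF u] assms(2) by (auto intro!: continuous_on_sum)
  have "J n = (\<Sum>i<n. I i)" for n
    by (rule has_integral_unique[OF J]) (intro has_integral_sum assms(1) finite_lessThan)
  then have "J = (\<lambda>n. \<Sum>i<n. I i)" by auto
  then have s: "I sums K" using JK by (simp add: sums_def)
  then show "summable I" and "((\<lambda>x. \<Sum>n. f n x) has_integral (\<Sum>n. I n)) {a..b}"
    using K by (auto simp: sums_iff)
qed

definition trig_series :: "(nat \<Rightarrow> real) \<Rightarrow> (nat \<Rightarrow> real) \<Rightarrow> real \<Rightarrow> real" where
  "trig_series a b x = (\<Sum>n. a n * cos (real n * x) + b n * sin (real n * x))"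

lemma abs_trig_term_le: "\<bar>a * cos x + b * sin x\<bar> \<le> \<bar>a\<bar> + \<bar>b :: real\<bar>"
proof -
  have "\<bar>a * cos x\<bar> \<le> \<bar>a\<bar>" "\<bar>b * sin x\<bar> \<le> \<bar>b\<bar>"
    by (auto simp: abs_mult intro!: mult_left_le)
  then show ?thesis by linarith
qed

lemma summable_trig_terms:
  assumes "summable (\<lambda>n. \<bar>a n\<bar> + \<bar>b n :: real\<bar>)"
  shows "summable (\<lambda>n. a n * cos (real n * x) + b n * sin (real n * x))"
  by (rule summable_comparison_test'[OF assms, of 0]) (use abs_trig_term_le in auto)

lemma abs_trig_series_le:
  assumes "summable (\<lambda>n. \<bar>a n\<bar> + \<bar>b n :: real\<bar>)"
  shows "\<bar>trig_series a b x\<bar> \<le> (\<Sum>n. \<bar>a n\<bar> + \<bar>b n\<bar>)"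
proof -
  have "norm (\<Sum>n. a n * cos (real n * x) + b n * sin (real n * x)) \<le> (\<Sum>n. \<bar>a n\<bar> + \<bar>b n\<bar>)"
    by (rule norm_suminf_le[OF _ assms]) (use abs_trig_term_le in auto)
  then show ?thesis by (simp add: trig_series_def)
qed

lemma uniform_limit_trig_series:
  assumes "summable (\<lambda>n. \<bar>a n\<bar> + \<bar>b n :: real\<bar>)"
  shows "uniform_limit UNIV (\<lambda>n x. \<Sum>i<n. a i * cos (real i * x) + b i * sin (real i * x))
           (trig_series a b) sequentially"
  unfolding trig_series_def
  by (rule Weierstrass_m_test[OF _ assms]) (use abs_trig_term_le in auto)

lemma trig_series_has_real_derivative:
  assumes "summable (\<lambda>n. \<bar>a n\<bar> + \<bar>b n\<bar>)" "summable (\<lambda>n. real n * (\<bar>a n\<bar> + \<bar>b n\<bar>))"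
  shows "(trig_series a b has_real_derivative
            trig_series (\<lambda>n. real n * b n) (\<lambda>n. - real n * a n) x) (at x)"
proof -
  have s: "summable (\<lambda>n. \<bar>real n * b n\<bar> + \<bar>- real n * a n\<bar>)"
    using assms(2) by (simp add: abs_mult algebra_simps)
  have "((\<lambda>x. \<Sum>n. a n * cos (real n * x) + b n * sin (real n * x)) has_real_derivative
      (\<Sum>n. real n * b n * cos (real n * x) + - real n * a n * sin (real n * x))) (at x)"
  proof (rule has_field_derivative_series'(2)[OF convex_UNIV])
    show "uniformly_convergent_on UNIV
        (\<lambda>n x. \<Sum>i<n. real i * b i * cos (real i * x) + - real i * a i * sin (real i * x))"
      using uniform_limit_trig_series[OF s] uniformly_convergent_on_def by blast
    show "summable (\<lambda>n. a n * cos (real n * 0) + b n * sin (real n * 0))"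
      by (rule summable_trig_terms[OF assms(1)])
    show "0 \<in> (UNIV :: real set)" "x \<in> interior UNIV" by auto
  qed (auto intro!: derivative_eq_intros)
  then show ?thesis by (simp add: trig_series_def[abs_def])
qed

text \<open>Weights bounded by 1 keep the majorant of the series, so Tannery's theorem allows the
  limit mode by mode. It is applied with the weights r^n for Fourier inversion and with (1 + r + ...
  + r^(n-1)) / n for the half-Laplacian.\<close>

lemma trig_series_tendsto_weights:
  assumes "summable (\<lambda>n. \<bar>a n\<bar> + \<bar>b n :: real\<bar>)"
    and "\<And>n. ((\<lambda>r. w r n) \<longlongrightarrow> l n) F"
    and "\<forall>\<^sub>F r in F. \<forall>n. \<bar>w r n\<bar> \<le> (1::real)"
    and "F \<noteq> bot"
  shows "((\<lambda>r. trig_series (\<lambda>n. w r n * a n) (\<lambda>n. w r n * b n) x) \<longlongrightarrow>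
           trig_series (\<lambda>n. l n * a n) (\<lambda>n. l n * b n) x) F"
  unfolding trig_series_def
proof (rule tannerys_theorem[OF _ _ assms(1,4), THEN conjunct2, THEN conjunct2])
  show "((\<lambda>r. w r n * a n * cos (real n * x) + w r n * b n * sin (real n * x)) \<longlongrightarrow>
      l n * a n * cos (real n * x) + l n * b n * sin (real n * x)) F" for n
    by (intro tendsto_intros assms)
  have "norm (w r n * a n * cos (real n * x) + w r n * b n * sin (real n * x)) \<le> \<bar>a n\<bar> + \<bar>b n\<bar>"
    if "\<forall>n. \<bar>w r n\<bar> \<le> 1" for r n
  proof -
    have "\<bar>w r n * a n\<bar> \<le> \<bar>a n\<bar>" "\<bar>w r n * b n\<bar> \<le> \<bar>b n\<bar>"
      using that by (auto simp: abs_mult intro!: mult_left_le_one_le)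
    then show ?thesis using abs_trig_term_le[of "w r n * a n" "real n * x" "w r n * b n"] by simp
  qed
  then show "\<forall>\<^sub>F (n, r) in at_top \<times>\<^sub>F F.
      norm (w r n * a n * cos (real n * x) + w r n * b n * sin (real n * x)) \<le> \<bar>a n\<bar> + \<bar>b n\<bar>"
    using assms(3) unfolding eventually_prod_filter
    by (intro exI[of _ "\<lambda>_. True"] exI[of _ "\<lambda>r. \<forall>n. \<bar>w r n\<bar> \<le> 1"]) auto
qed

section \<open>The Poisson kernel\<close>

definition poisson :: "real \<Rightarrow> real \<Rightarrow> real" where
  "poisson r z = (1 - r\<^sup>2) / (1 - 2 * r * cos z + r\<^sup>2)"

text \<open>The denominator is the squared distance from r to e^{iz}; in particular it is at least
  sin^2 z for every r.\<close>

lemma poisson_denom: "1 - 2 * r * cos z + r\<^sup>2 = (r - cos z)\<^sup>2 + (sin z)\<^sup>2" for r z :: real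
  using sin_cos_squared_add[of z] by (simp add: power2_eq_square algebra_simps)

lemma poisson_denom_pos:
  assumes "0 \<le> r" "r < (1::real)"
  shows "0 < 1 - 2 * r * cos z + r\<^sup>2"
proof -
  have "2 * r * cos z \<le> 2 * r" using assms by (simp add: mult_left_le)
  moreover have "0 < (1 - r)\<^sup>2" using assms by simp
  ultimately show ?thesis by (simp add: power2_eq_square algebra_simps)
qed

lemma poisson_nonneg: "0 \<le> r \<Longrightarrow> r < 1 \<Longrightarrow> 0 \<le> poisson r z"
  using poisson_denom_pos[of r z] by (auto simp: poisson_def power2_eq_square mult_le_one)

lemma continuous_on_poisson [continuous_intros]:
  fixes f :: "real \<Rightarrow> real"
  assumes "0 \<le> r" "r < 1" "continuous_on S f"
  shows "continuous_on S (\<lambda>x. poisson r (f x))"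
  unfolding poisson_def using poisson_denom_pos[OF assms(1,2)]
  by (intro continuous_intros assms(3)) (auto simp: less_imp_neq[symmetric])

text \<open>With w = r e^{iz} the kernel is the real part of (1 + w) / (1 - w) = 2 / (1 - w) - 1, so
  this is a geometric series.\<close>

lemma poisson_sums:
  assumes "0 \<le> r" "r < 1"
  shows "(\<lambda>n. (if n = 0 then 1 else 2) * r ^ n * cos (real n * z)) sums poisson r z"
proof -
  define w where "w = complex_of_real r * cis z"
  have nw: "norm w < 1" using assms by (simp add: w_def norm_mult)
  have w1: "w \<noteq> 1" using nw by auto
  have "(\<lambda>n. Re (w ^ n)) sums Re (1 / (1 - w))"
    using geometric_sums[OF nw] sums_Re by blast
  then have 1: "(\<lambda>n. r ^ n * cos (real n * z)) sums Re (1 / (1 - w))"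
    by (simp add: w_def power_mult_distrib Complex.DeMoivre flip: of_real_power)
  \<comment> \<open>Doubling the series counts the constant mode twice; the subtracted sequence,
    supported at n = 0, corrects this.\<close>
  have "(\<lambda>n. 2 * (r ^ n * cos (real n * z)) - (if n = 0 then 1 else 0)) sums
      (2 * Re (1 / (1 - w)) - 1)"
    by (intro sums_diff sums_mult 1) (use sums_single[of 0 "\<lambda>_. 1::real"] in simp)
  moreover have "2 * Re (1 / (1 - w)) - 1 = poisson r z"
  proof -
    have re: "Re w = r * cos z" "Im w = r * sin z" by (auto simp: w_def)
    have d: "(1 - r * cos z)\<^sup>2 + (r * sin z)\<^sup>2 = 1 - 2 * r * cos z + r\<^sup>2"
      using sin_cos_squared_add[of z]
      by (simp add: power2_eq_square algebra_simps flip: distrib_left)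
    have "Re (1 / (1 - w)) = (1 - r * cos z) / (1 - 2 * r * cos z + r\<^sup>2)"
      by (simp add: Re_divide re flip: d)
    then show ?thesis using poisson_denom_pos[OF assms, of z]
      by (simp add: poisson_def field_simps)
  qed
  moreover have "2 * (r ^ n * cos (real n * z)) - (if n = 0 then 1 else 0) =
      (if n = 0 then 1 else 2) * r ^ n * cos (real n * z)" for n
    by simp
  ultimately show ?thesis by simp
qed

lemma has_integral_cos_nat:
  "((\<lambda>x. cos (real n * x)) has_integral (if n = 0 then 2 * pi else 0)) {-pi..pi}"
proof (cases "n = 0")
  case True
  then show ?thesis using has_integral_const_real[of "1::real" "-pi" pi] by simp
next
  case False
  have "((\<lambda>x. cos (real n * x)) has_integral (sin (real n * pi) / n - sin (real n * (-pi)) / n)) {-pi..pi}"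
    by (rule fundamental_theorem_of_calculus)
      (use False in \<open>auto intro!: derivative_eq_intros simp flip: has_real_derivative_iff_has_vector_derivative\<close>)
  then show ?thesis using False by simp
qed

lemma has_integral_poisson:
  assumes "0 \<le> r" "r < 1"
  shows "(poisson r has_integral 2 * pi) {-pi..pi}"
proof -
  have "((\<lambda>x. \<Sum>n. (if n = 0 then 1 else 2) * r ^ n * cos (real n * x)) has_integral
      (\<Sum>n. (if n = 0 then 1 else 2) * r ^ n * (if n = 0 then 2 * pi else 0))) {-pi..pi}"
  proof (rule has_integral_series(1)[where M = "\<lambda>n. 2 * r ^ n"])
    show "summable (\<lambda>n. 2 * r ^ n)" using assms by (intro summable_mult summable_geometric) auto
    show "\<bar>(if n = 0 then 1 else 2) * r ^ n * cos (real n * x)\<bar> \<le> 2 * r ^ n" for n x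
    proof -
      have "r ^ n * \<bar>cos (real n * x)\<bar> \<le> r ^ n" using assms by (simp add: mult_left_le)
      then show ?thesis using assms by (simp add: abs_mult power_0_left)
    qed
  qed (intro has_integral_mult_right has_integral_cos_nat continuous_intros)+
  moreover have "(\<lambda>n. (if n = 0 then 1 else 2) * r ^ n * (if n = 0 then 2 * pi else 0)) sums (2 * pi)"
    using sums_single[of 0 "\<lambda>_. 2 * pi"] by (rule sums_cong[THEN iffD1, rotated]) auto
  moreover have "(\<Sum>n. (if n = 0 then 1 else 2) * r ^ n * cos (real n * x)) = poisson r x" for x
    using poisson_sums[OF assms] by (simp add: sums_iff)
  ultimately show ?thesis by (simp add: sums_iff)
qed

lemma trig_series_diff:
  assumes "summable (\<lambda>n. \<bar>a n\<bar> + \<bar>b n :: real\<bar>)" "summable (\<lambda>n. \<bar>c n\<bar> + \<bar>d n :: real\<bar>)"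
  shows "trig_series (\<lambda>n. a n - c n) (\<lambda>n. b n - d n) x = trig_series a b x - trig_series c d x"
  unfolding trig_series_def
  by (subst suminf_diff[OF summable_trig_terms[OF assms(1)] summable_trig_terms[OF assms(2)]])
    (simp add: algebra_simps)

lemma trig_series_cmult:
  assumes "summable (\<lambda>n. \<bar>a n\<bar> + \<bar>b n :: real\<bar>)"
  shows "trig_series (\<lambda>n. c * a n) (\<lambda>n. c * b n) x = c * trig_series a b x"
  unfolding trig_series_def
  by (subst suminf_mult[OF summable_trig_terms[OF assms], symmetric]) (simp add: algebra_simps)

section \<open>Periodic functions and their integrals over a period\<close>

lemma periodic_int:
  assumes "periodic f"
  shows "f (x + of_int n * (2 * pi)) = f x"
proof -
  have nat: "f (x + real n * (2 * pi)) = f x" for x and n :: nat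
  proof (induction n)
    case (Suc n)
    have "f (x + real (Suc n) * (2 * pi)) = f ((x + real n * (2 * pi)) + 2 * pi)"
      by (simp add: algebra_simps)
    also have "\<dots> = f x" using assms Suc unfolding periodic_def by metis
    finally show ?case .
  qed simp
  show ?thesis
  proof (cases "0 \<le> n")
    case True
    then show ?thesis using nat[of x "nat n"] by simp
  next
    case False
    then show ?thesis using nat[of "x + of_int n * (2 * pi)" "nat (- n)"] by simp
  qed
qed

lemma periodic_reduce:
  assumes "periodic f"
  obtains y where "y \<in> {-pi..pi}" "f y = f x"
proof -
  define n where "n = \<lfloor>(x + pi) / (2 * pi)\<rfloor>"
  have "of_int n \<le> (x + pi) / (2 * pi)" "(x + pi) / (2 * pi) < of_int n + 1"
    by (auto simp: n_def)
  then have "of_int n * (2 * pi) \<le> x + pi" "x + pi \<le> (of_int n + 1) * (2 * pi)"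
    by (simp_all add: field_simps)
  then have "x + of_int (- n) * (2 * pi) \<in> {-pi..pi}"
    by (simp add: algebra_simps)
  then show ?thesis using periodic_int[OF assms, of x "- n"] that by blast
qed

text \<open>If g is a primitive of f, the integral over the period centred at y is g (y + pi) - g (y
  - pi), whose derivative in y vanishes by periodicity.\<close>

lemma integral_periodic_shift:
  fixes f :: "real \<Rightarrow> real"
  assumes "periodic f" "continuous_on UNIV f"
  shows "((\<lambda>z. f (x + z)) has_integral integral {-pi..pi} f) {-pi..pi}"
proof -
  \<comment> \<open>The extra 1 keeps y - pi and y + pi interior for |y| <= |x|, so that g has
    two-sided derivatives there.\<close>
  define A where "A = \<bar>x\<bar> + pi + 1"
  obtain g where g: "\<And>y. y \<in> {-A..A} \<Longrightarrow> (g has_vector_derivative f y) (at y within {-A..A})"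
    using antiderivative_continuous[of "-A" A f] continuous_on_subset[OF assms(2)] by blast
  have g': "(g has_real_derivative f y) (at y)" if "y \<in> {-A<..<A}" for y
    using g[of y] that at_within_interior[of y "{-A..A}"]
    by (auto simp: has_real_derivative_iff_has_vector_derivative)
  have int: "((\<lambda>z. f (y + z)) has_integral (g (y + pi) - g (y - pi))) {-pi..pi}"
    if "\<bar>y\<bar> \<le> \<bar>x\<bar>" for y
  proof -
    have "((\<lambda>z. f (y + z)) has_integral (g (y + pi) - g (y + - pi))) {-pi..pi}"
    proof (rule fundamental_theorem_of_calculus)
      fix z assume "z \<in> {-pi..pi}"
      then have "(g has_real_derivative f (y + z)) (at (y + z))"
        using that by (intro g') (auto simp: A_def)
      then have "((\<lambda>z. g (y + z)) has_real_derivative f (y + z)) (at z)"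
        using DERIV_shift[of g "f (y + z)" z y] by (simp add: add.commute)
      then show "((\<lambda>z. g (y + z)) has_vector_derivative f (y + z)) (at z within {-pi..pi})"
        by (simp add: has_real_derivative_iff_has_vector_derivative has_vector_derivative_at_within)
    qed simp
    then show ?thesis by simp
  qed
  have "\<exists>c. \<forall>y \<in> {-\<bar>x\<bar>..\<bar>x\<bar>}. g (y + pi) - g (y - pi) = c"
  proof (rule has_field_derivative_zero_constant)
    fix y assume y: "y \<in> {-\<bar>x\<bar>..\<bar>x\<bar>}"
    have "f (y - pi) = f (y + pi)" using assms(1) unfolding periodic_def
      by (metis add.commute add_diff_cancel_left' diff_add_eq mult_2)
    moreover have "((\<lambda>y. g (y + pi) - g (y - pi)) has_real_derivative f (y + pi) - f (y - pi)) (at y)"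
      using y g'[of "y + pi"] g'[of "y - pi"] DERIV_shift[of g _ y pi] DERIV_shift[of g _ y "- pi"]
        pi_gt_zero
      by (intro DERIV_diff) (auto simp: A_def simp del: pi_gt_zero)
    ultimately show "((\<lambda>y. g (y + pi) - g (y - pi)) has_real_derivative 0) (at y within {-\<bar>x\<bar>..\<bar>x\<bar>})"
      by (simp add: has_field_derivative_at_within)
  qed simp
  then have "g (x + pi) - g (x - pi) = g (0 + pi) - g (0 - pi)" by (metis abs_ge_minus_self abs_ge_self
      abs_ge_zero atLeastAtMost_iff neg_le_0_iff_le minus_le_iff)
  moreover have "integral {-pi..pi} f = g (0 + pi) - g (0 - pi)"
    using int[of 0] by (auto intro: integral_unique)
  ultimately show ?thesis using int[of x] by simp
qed

section \<open>Fourier coefficients and inversion by Abel summation\<close>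

text \<open>The case distinction on n makes
  \<open>trig_series (fourier_cos f) (fourier_sin f)\<close> the Fourier series itself, without a
  halved constant term.\<close>

definition fourier_cos :: "(real \<Rightarrow> real) \<Rightarrow> nat \<Rightarrow> real" where
  "fourier_cos f n = (if n = 0 then 1 else 2) / (2 * pi) * integral {-pi..pi} (\<lambda>y. f y * cos (real n * y))"

definition fourier_sin :: "(real \<Rightarrow> real) \<Rightarrow> nat \<Rightarrow> real" where
  "fourier_sin f n = (if n = 0 then 1 else 2) / (2 * pi) * integral {-pi..pi} (\<lambda>y. f y * sin (real n * y))"

lemma periodic_bounded:
  assumes "periodic f" "continuous_on UNIV f"
  obtains B where "\<And>x. \<bar>f x\<bar> \<le> B" "0 < B"
proof -
  have "compact (f ` {-pi..pi})"
    by (intro compact_continuous_image continuous_on_subset[OF assms(2)]) auto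
  then obtain B where B: "0 < B" "\<And>y. y \<in> {-pi..pi} \<Longrightarrow> \<bar>f y\<bar> \<le> B"
    using compact_imp_bounded bounded_pos by (metis (mono_tags, opaque_lifting) imageI real_norm_def)
  have "\<bar>f x\<bar> \<le> B" for x using periodic_reduce[OF assms(1), of x] B(2) by metis
  then show ?thesis using that B(1) by blast
qed

lemma poisson_periodic: "poisson r (z + 2 * pi) = poisson r z"
  by (simp add: poisson_def)

text \<open>Expanding the kernel into cosines and splitting cos (n (y - x)) produces the Fourier
  coefficients of f, damped by r^n. Boundedness of f and the geometric factor justify termwise
  integration.\<close>

lemma has_integral_poisson_convolution:
  assumes "periodic f" "continuous_on UNIV f" "0 \<le> r" "r < 1"
  shows "((\<lambda>z. poisson r z * f (x + z)) has_integral
     2 * pi * trig_series (\<lambda>n. r ^ n * fourier_cos f n) (\<lambda>n. r ^ n * fourier_sin f n) x) {-pi..pi}"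
proof -
  obtain B where B: "\<And>x. \<bar>f x\<bar> \<le> B" "0 < B" using periodic_bounded[OF assms(1,2)] by blast
  note cf = continuous_on_subset[OF assms(2) subset_UNIV]
  define e where "e n = (if n = 0 then 1 else 2 :: real)" for n :: nat
  define h where "h y = poisson r (y - x) * f y" for y
  define C where "C n = integral {-pi..pi} (\<lambda>y. f y * cos (real n * y))" for n
  define S where "S n = integral {-pi..pi} (\<lambda>y. f y * sin (real n * y))" for n
  define I where "I n = e n * r ^ n * (cos (real n * x) * C n + sin (real n * x) * S n)" for n
  have coeff: "((\<lambda>y. e n * r ^ n * cos (real n * (y - x)) * f y) has_integral I n) {-pi..pi}" for n
  proof -
    have "((\<lambda>y. f y * cos (real n * y)) has_integral C n) {-pi..pi}"
      "((\<lambda>y. f y * sin (real n * y)) has_integral S n) {-pi..pi}"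
      unfolding C_def S_def
      by (intro integrable_integral integrable_continuous_real continuous_intros cf)+
    then have "((\<lambda>y. e n * r ^ n * (cos (real n * x) * (f y * cos (real n * y)) + sin (real n * x) * (f y * sin (real n * y))))
        has_integral I n) {-pi..pi}"
      unfolding I_def by (intro has_integral_mult_right has_integral_add)
    then show ?thesis
      by (rule has_integral_eq[rotated]) (simp add: right_diff_distrib cos_diff algebra_simps)
  qed
  have cont: "continuous_on {-pi..pi} (\<lambda>y. e n * r ^ n * cos (real n * (y - x)) * f y)" for n
    by (intro continuous_intros cf)
  have bound: "\<bar>e n * r ^ n * cos (real n * (y - x)) * f y\<bar> \<le> 2 * r ^ n * B" for n y
  proof -
    have "\<bar>cos (real n * (y - x))\<bar> * \<bar>f y\<bar> \<le> 1 * B" by (intro mult_mono B(1)) auto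
    moreover have "0 \<le> e n * r ^ n" "e n * r ^ n \<le> 2 * r ^ n" using assms by (auto simp: e_def)
    ultimately have "(e n * r ^ n) * (\<bar>cos (real n * (y - x))\<bar> * \<bar>f y\<bar>) \<le> (2 * r ^ n) * (1 * B)"
      using assms(3) by (intro mult_mono[of "e n * r ^ n"]) auto
    then show ?thesis
      using assms(3) by (simp add: abs_mult mult.assoc e_def split: if_splits)
  qed
  have "summable (\<lambda>n. 2 * r ^ n * B)"
    using assms by (intro summable_mult2 summable_mult summable_geometric) auto
  then have ser: "((\<lambda>y. \<Sum>n. e n * r ^ n * cos (real n * (y - x)) * f y) has_integral (\<Sum>n. I n)) {-pi..pi}"
    and sI: "summable I"
    by (rule has_integral_series[OF coeff cont bound])+
  have "(\<Sum>n. e n * r ^ n * cos (real n * (y - x)) * f y) = h y" for y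
    using sums_mult2[OF poisson_sums[OF assms(3,4), of "y - x"], of "f y"]
    by (simp add: sums_iff h_def e_def)
  with ser have h: "(h has_integral (\<Sum>n. I n)) {-pi..pi}" by simp
  have I: "I n = 2 * pi * (r ^ n * fourier_cos f n * cos (real n * x) + r ^ n * fourier_sin f n * sin (real n * x))" for n
    by (simp add: I_def C_def S_def e_def fourier_cos_def fourier_sin_def field_simps)
  then have "I = (\<lambda>n. 2 * pi * (r ^ n * fourier_cos f n * cos (real n * x) + r ^ n * fourier_sin f n * sin (real n * x)))"
    by auto
  with sI have "summable (\<lambda>n. 2 * pi * (r ^ n * fourier_cos f n * cos (real n * x) + r ^ n * fourier_sin f n * sin (real n * x)))"
    by (simp only:)
  then have "(\<Sum>n. I n) = 2 * pi * trig_series (\<lambda>n. r ^ n * fourier_cos f n) (\<lambda>n. r ^ n * fourier_sin f n) x"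
    using suminf_mult[of "\<lambda>n. r ^ n * fourier_cos f n * cos (real n * x) + r ^ n * fourier_sin f n * sin (real n * x)" "2 * pi"]
      summable_cmult_iff[of "2 * pi" "\<lambda>n. r ^ n * fourier_cos f n * cos (real n * x) + r ^ n * fourier_sin f n * sin (real n * x)"]
    by (simp add: trig_series_def I)
  \<comment> \<open>The coefficients are integrals over the period centred at 0, while the
    convolution is centred at x; periodicity of h bridges the two.\<close>
  moreover have "((\<lambda>z. h (x + z)) has_integral integral {-pi..pi} h) {-pi..pi}"
  proof (rule integral_periodic_shift)
    have "h (y + 2 * pi) = h y" for y
      using assms(1) poisson_periodic[of r "y - x"] by (simp add: h_def periodic_def algebra_simps)
    then show "periodic h" by (simp add: periodic_def)
    show "continuous_on UNIV h" unfolding h_def by (intro continuous_intros assms)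
  qed
  ultimately show ?thesis using h by (simp add: h_def integral_unique)
qed

text \<open>Cosine decreases on [0, pi], so the denominator is at least its value at \<delta>, which
  exceeds or equals sin^2 \<delta> whatever r is. The numerator then makes the kernel vanish
  uniformly away from 0 as r tends to 1.\<close>

lemma poisson_le_off_zero:
  assumes "0 \<le> r" "r < 1" "0 < \<delta>" "\<delta> < pi" "\<delta> \<le> \<bar>z\<bar>" "\<bar>z\<bar> \<le> pi"
  shows "poisson r z \<le> (1 - r\<^sup>2) / (sin \<delta>)\<^sup>2"
  unfolding poisson_def
proof (rule divide_left_mono)
  have "cos z \<le> cos \<delta>" using assms cos_monotone_0_pi_le[of \<delta> "\<bar>z\<bar>"] by simp
  then have "1 - 2 * r * cos \<delta> + r\<^sup>2 \<le> 1 - 2 * r * cos z + r\<^sup>2"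
    using assms by (simp add: mult_left_mono)
  then show "(sin \<delta>)\<^sup>2 \<le> 1 - 2 * r * cos z + r\<^sup>2"
    using poisson_denom[of r \<delta>] by (smt (verit) zero_le_power2)
  show "0 \<le> 1 - r\<^sup>2" using assms by (simp add: power2_eq_square mult_le_one)
  show "0 < (1 - 2 * r * cos z + r\<^sup>2) * (sin \<delta>)\<^sup>2"
    using assms poisson_denom_pos[of r z] sin_gt_zero[of \<delta>] by simp
qed

lemma at_left_1_unit_interval: "\<forall>\<^sub>F r in at_left (1::real). r \<in> {0<..<1}"
  by (rule eventually_at_left_field[THEN iffD2]) (auto intro!: exI[of _ 0])

text \<open>The Poisson kernel is an approximate identity: it is nonnegative, has constant mass 2
  pi, and concentrates at 0. Continuity of f controls |z| < \<delta>, boundedness of f the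
  rest.\<close>

lemma poisson_convolution_tendsto:
  assumes "periodic f" "continuous_on UNIV f"
  shows "((\<lambda>r. integral {-pi..pi} (\<lambda>z. poisson r z * f (x + z))) \<longlongrightarrow> 2 * pi * f x) (at_left 1)"
proof (rule tendstoI)
  fix e :: real assume e: "0 < e"
  obtain B where B: "\<And>x. \<bar>f x\<bar> \<le> B" "0 < B" using periodic_bounded[OF assms] by blast
  \<comment> \<open>The near part contributes at most 2 pi \<epsilon> = e / 2; the far part, 4 pi B
    q, is below e / 2 for r close to 1.\<close>
  define \<epsilon> where "\<epsilon> = e / (4 * pi)"
  have "\<epsilon> > 0" using e by (simp add: \<epsilon>_def)
  then obtain \<delta>0 where \<delta>0: "\<delta>0 > 0" "\<And>y. \<bar>y - x\<bar> < \<delta>0 \<Longrightarrow> \<bar>f y - f x\<bar> < \<epsilon>"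
    using assms(2) unfolding continuous_on_iff dist_real_def by (metis UNIV_I)
  \<comment> \<open>The cap at 1 ensures \<delta> < pi, so that sin \<delta> > 0.\<close>
  define \<delta> where "\<delta> = min \<delta>0 1"
  have \<delta>: "0 < \<delta>" "\<delta> < pi" "\<delta> \<le> \<delta>0" using \<delta>0 pi_gt3 by (auto simp: \<delta>_def)
  have lim: "((\<lambda>r. 4 * pi * B * ((1 - r\<^sup>2) / (sin \<delta>)\<^sup>2)) \<longlongrightarrow> 4 * pi * B * ((1 - 1\<^sup>2) / (sin \<delta>)\<^sup>2)) (at_left (1::real))"
    by (intro tendsto_intros) (use \<delta> sin_gt_zero[of \<delta>] in auto)
  have ev: "\<forall>\<^sub>F r in at_left (1::real). 4 * pi * B * ((1 - r\<^sup>2) / (sin \<delta>)\<^sup>2) < e / 2"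
    by (rule order_tendstoD(2)[OF lim]) (use e in simp)

  show "\<forall>\<^sub>F r in at_left 1. dist (integral {-pi..pi} (\<lambda>z. poisson r z * f (x + z))) (2 * pi * f x) < e"
    using ev at_left_1_unit_interval
  proof eventually_elim
    case (elim r)
    define q where "q = (1 - r\<^sup>2) / (sin \<delta>)\<^sup>2"
    have q0: "0 \<le> q" using elim by (simp add: q_def power2_eq_square mult_le_one)
    have r: "0 \<le> r" "r < 1" using elim by auto
    have cx: "continuous_on {-pi..pi} (\<lambda>z. f (x + z))"
      by (rule continuous_on_compose2[OF assms(2)]) (auto intro: continuous_intros)
    have p: "((\<lambda>z. poisson r z * f (x + z) - f x * poisson r z) has_integral
        (integral {-pi..pi} (\<lambda>z. poisson r z * f (x + z)) - f x * (2 * pi))) {-pi..pi}"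
      by (intro has_integral_diff has_integral_mult_right has_integral_poisson r integrable_integral
          integrable_continuous_real continuous_intros cx)
    have b: "((\<lambda>z. \<epsilon> * poisson r z + 2 * B * q) has_integral (\<epsilon> * (2 * pi) + 4 * pi * B * q)) {-pi..pi}"
      using has_integral_add[OF has_integral_mult_right[OF has_integral_poisson[OF r], of \<epsilon>]
          has_integral_const_real[of "2 * B * q" "-pi" pi]] by (simp add: mult_ac)
    have "\<bar>poisson r z * f (x + z) - f x * poisson r z\<bar> \<le> \<epsilon> * poisson r z + 2 * B * q"
      if "z \<in> {-pi..pi}" for z
    proof -
      have eq: "\<bar>poisson r z * f (x + z) - f x * poisson r z\<bar> = poisson r z * \<bar>f (x + z) - f x\<bar>"
        using poisson_nonneg[OF r, of z]
        by (simp add: abs_mult mult.commute[of "f x"] flip: right_diff_distrib)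
      show ?thesis
      proof (cases "\<bar>z\<bar> < \<delta>")
        case True
        then have "\<bar>f (x + z) - f x\<bar> \<le> \<epsilon>" using \<delta>0(2)[of "x + z"] \<delta> by simp
        then have "poisson r z * \<bar>f (x + z) - f x\<bar> \<le> poisson r z * \<epsilon>"
          by (intro mult_left_mono poisson_nonneg r)
        moreover have "0 \<le> 2 * B * q" using B q0 by simp
        ultimately show ?thesis unfolding eq by (simp add: mult_ac)
      next
        case False
        then have "poisson r z \<le> q"
          using that \<delta> poisson_le_off_zero[OF r \<delta>(1,2), of z] by (auto simp: q_def)
        moreover have "\<bar>f (x + z) - f x\<bar> \<le> 2 * B" using B(1)[of "x + z"] B(1)[of x] by linarith
        ultimately have "poisson r z * \<bar>f (x + z) - f x\<bar> \<le> q * (2 * B)"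
          using q0 by (intro mult_mono) auto
        moreover have "0 \<le> \<epsilon> * poisson r z" using \<open>\<epsilon> > 0\<close> poisson_nonneg[OF r, of z] by simp
        ultimately show ?thesis unfolding eq by (simp add: mult_ac)
      qed
    qed
    then have "norm (integral {-pi..pi} (\<lambda>z. poisson r z * f (x + z)) - f x * (2 * pi))
        \<le> \<epsilon> * (2 * pi) + 4 * pi * B * q"
      using integral_norm_bound_integral[OF has_integral_integrable[OF p] has_integral_integrable[OF b]]
        p b by (simp add: integral_unique)
    also have "\<dots> < e" using elim(1) e by (simp add: \<epsilon>_def q_def field_simps)
    finally show ?case by (simp add: dist_real_def mult_ac)
  qed
qed

text \<open>The weight gives absolute convergence of the series together with its termwise
  derivative, which covers f, f', H f and the derivative of H f at once.\<close>

definition trig_summable :: "(nat \<Rightarrow> real) \<Rightarrow> (nat \<Rightarrow> real) \<Rightarrow> bool" where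
  "trig_summable a b \<longleftrightarrow> summable (\<lambda>n. (1 + real n) * (\<bar>a n\<bar> + \<bar>b n\<bar>))"

lemma trig_summableD:
  assumes "trig_summable a b"
  shows "summable (\<lambda>n. \<bar>a n\<bar> + \<bar>b n\<bar>)" "summable (\<lambda>n. real n * (\<bar>a n\<bar> + \<bar>b n\<bar>))"
  by (rule summable_comparison_test'[OF assms[unfolded trig_summable_def], of 0];
      simp add: algebra_simps)+

text \<open>The Poisson integral of f is the series with damping r^n. As r tends to 1 it converges
  to f x as an approximate identity, and to the undamped series by absolute summability.\<close>

lemma fourier_inversion:
  assumes "periodic f" "continuous_on UNIV f"
    and "summable (\<lambda>n. \<bar>fourier_cos f n\<bar> + \<bar>fourier_sin f n\<bar>)"
  shows "f x = trig_series (fourier_cos f) (fourier_sin f) x"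
proof -
  have "((\<lambda>r. 2 * pi * trig_series (\<lambda>n. r ^ n * fourier_cos f n) (\<lambda>n. r ^ n * fourier_sin f n) x)
      \<longlongrightarrow> 2 * pi * trig_series (\<lambda>n. 1 ^ n * fourier_cos f n) (\<lambda>n. 1 ^ n * fourier_sin f n) x) (at_left 1)"
  proof (intro tendsto_intros trig_series_tendsto_weights assms(3))
    show "\<forall>\<^sub>F r in at_left (1::real). \<forall>n. \<bar>r ^ n\<bar> \<le> 1"
      using at_left_1_unit_interval by eventually_elim (auto intro!: power_le_one)
  qed auto
  moreover have "((\<lambda>r. 2 * pi * trig_series (\<lambda>n. r ^ n * fourier_cos f n) (\<lambda>n. r ^ n * fourier_sin f n) x)
      \<longlongrightarrow> 2 * pi * f x) (at_left 1)"
  proof (rule Lim_transform_eventually[OF poisson_convolution_tendsto[OF assms(1,2)]])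
    show "\<forall>\<^sub>F r in at_left 1. integral {-pi..pi} (\<lambda>z. poisson r z * f (x + z)) =
        2 * pi * trig_series (\<lambda>n. r ^ n * fourier_cos f n) (\<lambda>n. r ^ n * fourier_sin f n) x"
      using at_left_1_unit_interval
      by eventually_elim (auto intro!: integral_unique has_integral_poisson_convolution assms)
  qed
  ultimately show ?thesis using tendsto_unique[of "at_left (1::real)"] by fastforce
qed

section \<open>Lower bound for the half-Laplacian at a maximum\<close>

text \<open>The denominator equals (1 - r)^2 + 2 r (1 - cos z), and 1 - cos z = 2 sin^2(z/2) <= d^2
  / 2.\<close>

lemma poisson_ge_near_zero:
  assumes "0 \<le> r" "r < 1" "\<bar>z\<bar> \<le> d"
  shows "(1 - r\<^sup>2) / ((1 - r)\<^sup>2 + r * d\<^sup>2) \<le> poisson r z"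
  unfolding poisson_def
proof (rule divide_left_mono)
  have "\<bar>sin (z / 2)\<bar> \<le> \<bar>z / 2\<bar>" by (rule abs_sin_x_le_abs_x)
  also have "\<dots> \<le> d / 2" using assms by simp
  finally have "(sin (z / 2))\<^sup>2 \<le> (d / 2)\<^sup>2" by (metis abs_ge_zero power2_abs power_mono)
  then have "1 - cos z \<le> d\<^sup>2 / 2" using cos_double_sin[of "z / 2"] by (simp add: power2_eq_square)
  then have "2 * r * (1 - cos z) \<le> 2 * r * (d\<^sup>2 / 2)" using assms by (intro mult_left_mono) auto
  then show le: "1 - 2 * r * cos z + r\<^sup>2 \<le> (1 - r)\<^sup>2 + r * d\<^sup>2"
    by (simp add: power2_eq_square algebra_simps)
  show "0 \<le> 1 - r\<^sup>2" using assms by (simp add: power2_eq_square mult_le_one)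
  show "0 < ((1 - r)\<^sup>2 + r * d\<^sup>2) * (1 - 2 * r * cos z + r\<^sup>2)"
    using le poisson_denom_pos[OF assms(1,2), of z] by simp
qed

text \<open>
  The operator \<open>\<Lambda> = \<partial>\<^sub>x H\<close> is the limit of \<open>(f - P\<^sub>r f) / (1 - r)\<close> as \<open>r\<close> tends to 1, and at a
  maximum the mass \<open>m\<close> forces \<open>M - f\<close> to be large on average over the ball of radius \<open>m / M\<close>.
\<close>
lemma half_laplacian_ge_at_max:
  assumes "periodic f" "continuous_on UNIV f" "trig_summable (fourier_cos f) (fourier_sin f)"
    and "\<And>x. 0 \<le> f x" "\<And>x. f x \<le> M" "f x = M" "0 < M"
    and "integral {-pi..pi} f \<le> m" "0 < m" "m \<le> pi * M"
  shows "M\<^sup>2 / (pi * m) \<le> trig_series (\<lambda>n. real n * fourier_cos f n) (\<lambda>n. real n * fourier_sin f n) x"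
proof -
  define a b where ab: "a = fourier_cos f" "b = fourier_sin f"
  \<comment> \<open>With this radius 2 d M is twice the mass bound, so at least m of the area below
    M stays unfilled on the ball; \<open>m \<le> pi * M\<close> makes the ball fit into one
    period.\<close>
  define d where "d = m / M"
  have d: "0 < d" "d \<le> pi" "d * M = m" using assms by (auto simp: d_def field_simps)
  note sm = trig_summableD[OF assms(3), folded ab]
  \<comment> \<open>Since 1 - r^n = (1 - r) (1 + r + ... + r^(n-1)), the quotient (f - P_r f) / (1 -
    r) is the series of the half-Laplacian with these weights, which lie in [0, 1]. At n = 0
    division by zero gives weight 0, and the coefficient \<open>real n * a n\<close> vanishes there
    too.\<close>
  define w where "w r n = (\<Sum>j<n. r ^ j) / real n" for r :: real and n
  have w_le: "\<bar>w r n\<bar> \<le> 1" if "0 \<le> r" "r < 1" for r n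
  proof -
    have "(\<Sum>j<n. r ^ j) \<le> (\<Sum>j<n. 1)" using that by (intro sum_mono power_le_one) auto
    moreover have "0 \<le> (\<Sum>j<n. r ^ j)" using that by (intro sum_nonneg) auto
    ultimately show ?thesis by (auto simp: w_def divide_le_eq)
  qed
  have lim: "((\<lambda>r. trig_series (\<lambda>n. w r n * (real n * a n)) (\<lambda>n. w r n * (real n * b n)) x) \<longlongrightarrow>
      trig_series (\<lambda>n. w 1 n * (real n * a n)) (\<lambda>n. w 1 n * (real n * b n)) x) (at_left 1)"
  proof (intro trig_series_tendsto_weights)
    show "summable (\<lambda>n. \<bar>real n * a n\<bar> + \<bar>real n * b n\<bar>)"
      using sm(2) by (simp add: abs_mult algebra_simps)
    show "((\<lambda>r. w r n) \<longlongrightarrow> w 1 n) (at_left 1)" for n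
      unfolding w_def divide_inverse by (intro tendsto_intros)
    show "\<forall>\<^sub>F r in at_left (1::real). \<forall>n. \<bar>w r n\<bar> \<le> 1"
      using at_left_1_unit_interval by eventually_elim (auto intro!: w_le)
  qed simp
  have w1: "w 1 n * (real n * c) = real n * c" for n c by (simp add: w_def)
  \<comment> \<open>The factor 1 + r is what remains of 1 - r^2 after division by 1 - r.\<close>
  have low: "\<forall>\<^sub>F r in at_left (1::real). (1 + r) / ((1 - r)\<^sup>2 + r * d\<^sup>2) * m / (2 * pi) \<le>
      trig_series (\<lambda>n. w r n * (real n * a n)) (\<lambda>n. w r n * (real n * b n)) x"
    using at_left_1_unit_interval
  proof eventually_elim
    case (elim r)
    then have r: "0 \<le> r" "r < 1" by auto
    define K where "K = (1 - r\<^sup>2) / ((1 - r)\<^sup>2 + r * d\<^sup>2)"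
    define P where "P = trig_series (\<lambda>n. r ^ n * a n) (\<lambda>n. r ^ n * b n) x"
    have "0 < (1 - r)\<^sup>2 + r * d\<^sup>2" using r by (simp add: add_pos_nonneg)
    then have K0: "0 \<le> K" using r by (simp add: K_def power2_eq_square mult_le_one)
    have cx: "continuous_on S (\<lambda>z. f (x + z))" for S
      by (rule continuous_on_compose2[OF assms(2)]) (auto intro: continuous_intros)
    have full: "((\<lambda>z. M * poisson r z - poisson r z * f (x + z)) has_integral (M * (2 * pi) - 2 * pi * P)) {-pi..pi}"
      unfolding P_def ab
      by (intro has_integral_diff has_integral_mult_right has_integral_poisson r
          has_integral_poisson_convolution assms(1,2))
    have part: "((\<lambda>z. K * (M - f (x + z))) has_integral (K * (M * (2 * d) - integral {-d..d} (\<lambda>z. f (x + z))))) {-d..d}"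
      by (intro has_integral_mult_right has_integral_diff integrable_integral integrable_continuous_real cx)
        (use has_integral_const_real[of M "-d" d] d in \<open>simp add: mult_ac\<close>)
    \<comment> \<open>As f is nonnegative, the ball carries at most the full mass m, and 2 d M - m =
      m.\<close>
    have "integral {-d..d} (\<lambda>z. f (x + z)) \<le> integral {-pi..pi} (\<lambda>z. f (x + z))"
      by (intro integral_subset_le integrable_continuous_real cx) (use d assms(4) in auto)
    also have "\<dots> = integral {-pi..pi} f"
      by (rule integral_unique[OF integral_periodic_shift[OF assms(1,2)]])
    also have "\<dots> \<le> m" by (rule assms(8))
    finally have "m \<le> M * (2 * d) - integral {-d..d} (\<lambda>z. f (x + z))"
      using d by (simp add: algebra_simps)
    then have "K * m \<le> K * (M * (2 * d) - integral {-d..d} (\<lambda>z. f (x + z)))"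
      using K0 by (rule mult_left_mono)
    also have "\<dots> \<le> integral {-d..d} (\<lambda>z. M * poisson r z - poisson r z * f (x + z))"
    proof (rule has_integral_le[OF part integrable_integral])
      show "(\<lambda>z. M * poisson r z - poisson r z * f (x + z)) integrable_on {-d..d}"
        by (intro integrable_continuous_real continuous_intros cx r)
      fix z assume "z \<in> {-d..d}"
      then have "K \<le> poisson r z" unfolding K_def by (intro poisson_ge_near_zero r) auto
      then have "K * (M - f (x + z)) \<le> poisson r z * (M - f (x + z))"
        using assms(5)[of "x + z"] by (intro mult_right_mono) auto
      then show "K * (M - f (x + z)) \<le> M * poisson r z - poisson r z * f (x + z)"
        by (simp add: algebra_simps)
    qed
    \<comment> \<open>Enlarging the ball to the whole period only adds mass, because f stays below M
      and the kernel is nonnegative.\<close>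
    also have "\<dots> \<le> integral {-pi..pi} (\<lambda>z. M * poisson r z - poisson r z * f (x + z))"
    proof (intro integral_subset_le ballI integrable_continuous_real continuous_intros cx r)
      show "0 \<le> M * poisson r z - poisson r z * f (x + z)" for z
        using mult_left_mono[OF assms(5)[of "x + z"] poisson_nonneg[OF r, of z]] by (simp add: mult.commute)
    qed (use d in auto)
    also have "\<dots> = 2 * pi * (M - P)" using full by (simp add: integral_unique algebra_simps)
    finally have 1: "K * m / (2 * pi) \<le> M - P" by (simp add: field_simps)
    have P: "M - P = (1 - r) * trig_series (\<lambda>n. w r n * (real n * a n)) (\<lambda>n. w r n * (real n * b n)) x"
    proof -
      have eq: "(1 - r) * (w r n * (real n * c)) = c - r ^ n * c" for n c
      proof (cases "n = 0")
        case False
        have "(1 - r) * (w r n * (real n * c)) = (1 - r) * (\<Sum>j<n. r ^ j) * c"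
          using False by (simp add: w_def)
        also have "\<dots> = (1 - r ^ n) * c" by (simp only: one_diff_power_eq)
        also have "\<dots> = c - r ^ n * c" by (simp add: left_diff_distrib)
        finally show ?thesis .
      qed simp
      have wle: "\<bar>w r n * (real n * c)\<bar> \<le> real n * \<bar>c\<bar>" for n c
        using w_le[OF r, of n] by (simp add: abs_mult mult_left_le_one_le)
      have sw: "summable (\<lambda>n. \<bar>w r n * (real n * a n)\<bar> + \<bar>w r n * (real n * b n)\<bar>)"
        by (rule summable_comparison_test'[OF sm(2), of 0])
          (use wle in \<open>auto simp: distrib_left intro!: add_mono\<close>)
      have sr: "summable (\<lambda>n. \<bar>r ^ n * a n\<bar> + \<bar>r ^ n * b n\<bar>)"
        by (rule summable_comparison_test'[OF sm(1), of 0])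
          (use r in \<open>auto simp: abs_mult intro!: add_mono mult_left_le_one_le power_le_one\<close>)
      have "M = trig_series a b x"
        using fourier_inversion[OF assms(1,2), of x] sm(1) assms(6) by (simp add: ab)
      then show ?thesis
        by (simp add: P_def trig_series_diff[OF sm(1) sr, symmetric] trig_series_cmult[OF sw, symmetric] eq)
    qed
    have "K = (1 - r) * ((1 + r) / ((1 - r)\<^sup>2 + r * d\<^sup>2))"
      by (simp add: K_def power2_eq_square algebra_simps)
    with 1 have "(1 - r) * ((1 + r) / ((1 - r)\<^sup>2 + r * d\<^sup>2) * m / (2 * pi)) \<le>
        (1 - r) * trig_series (\<lambda>n. w r n * (real n * a n)) (\<lambda>n. w r n * (real n * b n)) x"
      unfolding P by (simp add: mult.assoc)
    then show ?case using r by (simp only: mult_le_cancel_left_pos[of "1 - r"] diff_gt_0_iff_gt)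
  qed
  have "((\<lambda>r. (1 + r) / ((1 - r)\<^sup>2 + r * d\<^sup>2) * m / (2 * pi)) \<longlongrightarrow>
      (1 + 1) / ((1 - 1)\<^sup>2 + 1 * d\<^sup>2) * m / (2 * pi)) (at_left (1::real))"
    by (intro tendsto_intros) (use d in auto)
  then have "(1 + 1) / ((1 - 1)\<^sup>2 + 1 * d\<^sup>2) * m / (2 * pi) \<le>
      trig_series (\<lambda>n. w 1 n * (real n * a n)) (\<lambda>n. w 1 n * (real n * b n)) x"
    by (rule tendsto_le[OF trivial_limit_at_left_real lim _ low])
  moreover have "(1 + 1) / ((1 - 1)\<^sup>2 + 1 * d\<^sup>2) * m / (2 * pi) = M\<^sup>2 / (pi * m)"
    using assms by (simp add: d_def power2_eq_square field_simps)
  ultimately show ?thesis by (simp add: w1 ab)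
qed

section \<open>The Hilbert transform as a Fourier multiplier\<close>

text \<open>For n >= 1 this is 1 + 2 cos z + ... + 2 cos ((n-1) z) + cos (n z), a modified Dirichlet
  kernel, grouped in consecutive pairs to suit induction on n.\<close>

definition conj_kernel :: "nat \<Rightarrow> real \<Rightarrow> real" where
  "conj_kernel n z = (\<Sum>j<n. cos (real j * z) + cos (real (Suc j) * z))"

text \<open>This is sin (n z) cot (z/2) = \<open>conj_kernel n z\<close> with the denominator
  cleared. In the induction step both increments equal 2 cos u cos (z/2) sin (z/2), where u = (n +
  1/2) z is the midpoint of n z and (n+1) z.\<close>

lemma sin_mult_cos_half: "sin (real n * z) * cos (z / 2) = conj_kernel n z * sin (z / 2)"
proof (induction n)
  case (Suc n)
  define u where "u = real n * z + z / 2"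
  have e: "real n * z = u - z / 2" "real (Suc n) * z = u + z / 2"
    by (auto simp: u_def algebra_simps)
  have "sin (real (Suc n) * z) * cos (z / 2) =
      sin (real n * z) * cos (z / 2) + (cos (real n * z) + cos (real (Suc n) * z)) * sin (z / 2)"
    unfolding e by (simp add: sin_add sin_diff cos_add cos_diff algebra_simps)
  then show ?case using Suc by (simp add: conj_kernel_def distrib_right)
qed (simp add: conj_kernel_def)

lemma abs_conj_kernel_le: "\<bar>conj_kernel n z\<bar> \<le> 2 * real n"
proof -
  have "\<bar>conj_kernel n z\<bar> \<le> (\<Sum>j<n. \<bar>cos (real j * z) + cos (real (Suc j) * z)\<bar>)"
    unfolding conj_kernel_def by (rule sum_abs)
  also have "\<dots> \<le> (\<Sum>j<n. 2)"
  proof (rule sum_mono)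
    fix j
    show "\<bar>cos (real j * z) + cos (real (Suc j) * z)\<bar> \<le> 2"
      using abs_cos_le_one[of "real j * z"] abs_cos_le_one[of "real (Suc j) * z"] by linarith
  qed
  finally show ?thesis by simp
qed

text \<open>Only the single constant term survives integration over [0, pi]. All modes n >= 1 thus
  get the same factor pi, which is why the Hilbert transform merely exchanges sine and cosine
  coefficients up to sign.\<close>

lemma has_integral_conj_kernel:
  "(conj_kernel n has_integral (if n = 0 then 0 else pi)) {0..pi}"
proof -
  have c: "((\<lambda>x. cos (real j * x)) has_integral (if j = 0 then pi else 0)) {0..pi}" for j
  proof (cases "j = 0")
    case True
    then show ?thesis using has_integral_const_real[of "1::real" 0 pi] by simp
  next
    case False
    have "((\<lambda>x. cos (real j * x)) has_integral (sin (real j * pi) / j - sin (real j * 0) / j)) {0..pi}"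
      by (rule fundamental_theorem_of_calculus)
        (use False in \<open>auto intro!: derivative_eq_intros simp flip: has_real_derivative_iff_has_vector_derivative\<close>)
    then show ?thesis using False by simp
  qed
  have "(conj_kernel n has_integral (\<Sum>j<n. (if j = 0 then pi else 0) + (if Suc j = 0 then pi else 0))) {0..pi}"
    unfolding conj_kernel_def[abs_def] by (intro has_integral_sum has_integral_add c finite_lessThan)
  moreover have "(\<Sum>j<n. if j = 0 then pi else 0) = (if n = 0 then 0 else pi)"
    by (simp add: sum.delta)
  ultimately show ?thesis by simp
qed

lemma has_integral_mirror:
  fixes k :: "real \<Rightarrow> real"
  assumes "((\<lambda>z. k (x - z)) has_integral I) {a..b}"
  shows "(k has_integral I) {x - b..x - a}"
proof -
  have "((\<lambda>z. k (x + z)) has_integral I) {-b..-a}"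
    using has_integral_reflect_lemma_real[OF assms] by simp
  from has_integral_shift_real_ivl[OF this, of "-x"] show ?thesis by (simp add: algebra_simps)
qed

lemma has_integral_translate:
  fixes k :: "real \<Rightarrow> real"
  assumes "((\<lambda>z. k (x + z)) has_integral I) {a..b}"
  shows "(k has_integral I) {x + a..x + b}"
  using has_integral_shift_real_ivl[OF assms, of "-x"] by (simp add: algebra_simps)

text \<open>
  After pairing \<open>x - z\<close> with \<open>x + z\<close> the integrand of the principal value extends continuously to
  \<open>z = 0\<close>, because \<open>sin (n z) cot (z / 2)\<close> is the cosine polynomial \<^const>\<open>conj_kernel\<close>.
\<close>
lemma hilbert_eq_trig_series:
  assumes "periodic f" "continuous_on UNIV f" "trig_summable (fourier_cos f) (fourier_sin f)"
  shows "hilbert f x = trig_series (\<lambda>n. - fourier_sin f n) (fourier_cos f) x"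
proof -
  define a b where ab: "a = fourier_cos f" "b = fourier_sin f"
  note sm = trig_summableD[OF assms(3), folded ab]
  \<comment> \<open>These are half the sine coefficients, in z, of the odd difference f (x - z) - f
    (x + z).\<close>
  define s where "s n = a n * sin (real n * x) - b n * cos (real n * x)" for n
  define G where "G z = (\<Sum>n. 2 * s n * conj_kernel n z)" for z
  have f: "f y = trig_series a b y" for y
    using fourier_inversion[OF assms(1,2), of y] sm(1) by (simp add: ab)
  have s: "\<bar>s n\<bar> \<le> \<bar>a n\<bar> + \<bar>b n\<bar>" for n
    using abs_trig_term_le[of "- b n" "real n * x" "a n"] by (simp add: s_def algebra_simps)
  have ck: "continuous_on S (conj_kernel n)" for n S
    unfolding conj_kernel_def[abs_def] by (intro continuous_intros)
  have bd: "\<bar>2 * s n * conj_kernel n z\<bar> \<le> 4 * (real n * (\<bar>a n\<bar> + \<bar>b n\<bar>))" for n z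
  proof -
    have "\<bar>s n\<bar> * \<bar>conj_kernel n z\<bar> \<le> (\<bar>a n\<bar> + \<bar>b n\<bar>) * (2 * real n)"
      using s abs_conj_kernel_le by (intro mult_mono) auto
    then show ?thesis by (simp add: abs_mult algebra_simps)
  qed
  have s4: "summable (\<lambda>n. 4 * (real n * (\<bar>a n\<bar> + \<bar>b n\<bar>)))" by (intro summable_mult sm)
  have "(G has_integral (\<Sum>n. 2 * s n * (if n = 0 then 0 else pi))) {0..pi}"
    unfolding G_def[abs_def]
    by (rule has_integral_series(1)[OF _ _ bd s4])
      (intro has_integral_mult_right has_integral_conj_kernel continuous_intros ck)+
  \<comment> \<open>At n = 0 the right side is -2 pi b 0, and b 0 = 0 because it is an integral of f
    times sin 0.\<close>
  moreover have "2 * s n * (if n = 0 then 0 else pi) = 2 * pi * (- b n * cos (real n * x) + a n * sin (real n * x))" for n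
    by (auto simp: s_def ab fourier_sin_def algebra_simps)
  moreover have "(\<Sum>n. 2 * pi * (- b n * cos (real n * x) + a n * sin (real n * x))) =
      2 * pi * trig_series (\<lambda>n. - b n) a x"
    unfolding trig_series_def by (rule suminf_mult summable_trig_terms)+ (use sm(1) in \<open>simp add: add.commute\<close>)
  ultimately have G: "(G has_integral 2 * pi * trig_series (\<lambda>n. - b n) a x) {0..pi}" by simp
  have pair: "f (x - z) * cot (z / 2) + - (f (x + z) * cot (z / 2)) = G z" if "z \<in> {0<..pi}" for z
  proof -
    have sz: "sin (z / 2) \<noteq> 0" using that sin_gt_zero[of "z / 2"] by auto
    have "(\<lambda>n. (a n * cos (real n * (x - z)) + b n * sin (real n * (x - z))) -
        (a n * cos (real n * (x + z)) + b n * sin (real n * (x + z)))) sums (f (x - z) - f (x + z))"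
      unfolding f trig_series_def by (intro sums_diff summable_sums summable_trig_terms sm)
    moreover have "(a n * cos (real n * (x - z)) + b n * sin (real n * (x - z))) -
        (a n * cos (real n * (x + z)) + b n * sin (real n * (x + z))) = 2 * s n * sin (real n * z)" for n
      by (simp add: s_def right_diff_distrib distrib_left sin_add sin_diff cos_add cos_diff algebra_simps)
    ultimately have "(\<lambda>n. 2 * s n * sin (real n * z) * cot (z / 2)) sums ((f (x - z) - f (x + z)) * cot (z / 2))"
      by (simp add: sums_mult2)
    moreover have "sin (real n * z) * cot (z / 2) = conj_kernel n z" for n
      using sin_mult_cos_half[of n z] sz by (simp add: cot_def field_simps)
    ultimately have "(\<lambda>n. 2 * s n * conj_kernel n z) sums ((f (x - z) - f (x + z)) * cot (z / 2))"
      by (simp add: mult.assoc)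
    then show ?thesis by (simp add: G_def sums_iff left_diff_distrib)
  qed
  define PV where "PV \<epsilon> = integral ({x - pi..x - \<epsilon>} \<union> {x + \<epsilon>..x + pi}) (\<lambda>y. f y / tan ((x - y) / 2))" for \<epsilon>
  have PV: "PV \<epsilon> = integral {\<epsilon>..pi} G" if "\<epsilon> \<in> {0<..<pi}" for \<epsilon>
  proof -
    have cot: "1 / tan u = cot u" for u :: real by (simp add: tan_def cot_def)
    have cc: "continuous_on {\<epsilon>..pi} (\<lambda>z. cot (z / 2))"
    proof -
      have "sin (z / 2) \<noteq> 0" if "z \<in> {\<epsilon>..pi}" for z
        using that \<open>\<epsilon> \<in> {0<..<pi}\<close> sin_gt_zero[of "z / 2"] by auto
      then show ?thesis unfolding cot_def by (intro continuous_intros) auto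
    qed
    have cm: "continuous_on S (\<lambda>z. f (x - z))" "continuous_on S (\<lambda>z. f (x + z))" for S
      by (rule continuous_on_compose2[OF assms(2)]; auto intro: continuous_intros)+
    define L R where "L = integral {\<epsilon>..pi} (\<lambda>z. f (x - z) * cot (z / 2))"
      and "R = integral {\<epsilon>..pi} (\<lambda>z. - (f (x + z) * cot (z / 2)))"
    have L: "((\<lambda>z. f (x - z) * cot (z / 2)) has_integral L) {\<epsilon>..pi}"
      and R: "((\<lambda>z. - (f (x + z) * cot (z / 2))) has_integral R) {\<epsilon>..pi}"
      unfolding L_def R_def
      by (intro integrable_integral integrable_continuous_real continuous_intros cc cm)+
    \<comment> \<open>The left piece is reflected by y = x - z and the right piece translated by y =
      x + z; the oddness of the cotangent gives the minus sign in R.\<close>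
    have "((\<lambda>y. f y / tan ((x - y) / 2)) has_integral L) {x - pi..x - \<epsilon>}"
      by (rule has_integral_mirror) (use L in \<open>simp add: cot[symmetric]\<close>)
    moreover have "((\<lambda>y. f y / tan ((x - y) / 2)) has_integral R) {x + \<epsilon>..x + pi}"
      by (rule has_integral_translate) (use R in \<open>simp add: cot[symmetric]\<close>)
    moreover have "{x - pi..x - \<epsilon>} \<inter> {x + \<epsilon>..x + pi} = {}" using that by auto
    ultimately have "PV \<epsilon> = L + R"
      unfolding PV_def by (intro integral_unique has_integral_Un) auto
    moreover have "(G has_integral (L + R)) {\<epsilon>..pi}"
      by (rule has_integral_eq[OF _ has_integral_add[OF L R]]) (use pair that in auto)
    ultimately show ?thesis by (simp add: integral_unique)
  qed
  \<comment> \<open>Since G is integrable up to 0, the principal value limit is continuity of the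
    integral in its lower endpoint.\<close>
  have "continuous_on {0..pi} (\<lambda>\<epsilon>. integral {\<epsilon>..pi} G)"
    using G by (intro indefinite_integral_continuous_1') (auto simp: has_integral_integrable)
  then have "((\<lambda>\<epsilon>. integral {\<epsilon>..pi} G) \<longlongrightarrow> integral {0..pi} G) (at 0 within {0..pi})"
    by (auto simp: continuous_on_def)
  then have lim: "((\<lambda>\<epsilon>. integral {\<epsilon>..pi} G) \<longlongrightarrow> 2 * pi * trig_series (\<lambda>n. - b n) a x) (at_right 0)"
    using G by (simp add: at_within_Icc_at_right integral_unique)
  have "(PV \<longlongrightarrow> 2 * pi * trig_series (\<lambda>n. - b n) a x) (at_right 0)"
  proof (rule Lim_transform_eventually[OF lim])
    have "\<forall>\<^sub>F \<epsilon> in at_right (0::real). \<epsilon> \<in> {0<..<pi}"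
      by (rule eventually_at_right_field[THEN iffD2]) (auto intro!: exI[of _ pi])
    then show "\<forall>\<^sub>F \<epsilon> in at_right 0. integral {\<epsilon>..pi} G = PV \<epsilon>"
      by eventually_elim (simp add: PV)
  qed
  then have "Lim (at_right 0) PV = 2 * pi * trig_series (\<lambda>n. - b n) a x"
    by (intro tendsto_Lim) auto
  then show ?thesis by (simp add: hilbert_def PV_def[abs_def] ab)
qed

lemma hilbert_has_real_derivative:
  assumes "periodic f" "continuous_on UNIV f" "trig_summable (fourier_cos f) (fourier_sin f)"
  shows "(hilbert f has_real_derivative
            trig_series (\<lambda>n. real n * fourier_cos f n) (\<lambda>n. real n * fourier_sin f n) x) (at x)"
proof -
  have "hilbert f = trig_series (\<lambda>n. - fourier_sin f n) (fourier_cos f)"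
    using hilbert_eq_trig_series[OF assms] by auto
  then show ?thesis
    using trig_series_has_real_derivative[of "\<lambda>n. - fourier_sin f n" "fourier_cos f" x]
      trig_summableD[OF assms(3)] by (simp add: add.commute)
qed

lemma hilbert_periodic:
  assumes "periodic f" "continuous_on UNIV f" "trig_summable (fourier_cos f) (fourier_sin f)"
  shows "hilbert f pi = hilbert f (- pi)"
  by (simp add: hilbert_eq_trig_series[OF assms] trig_series_def)

section \<open>Sobolev functions have absolutely summable weighted Fourier coefficients\<close>

definition wiener_norm :: "(real \<Rightarrow> real) \<Rightarrow> real" where
  "wiener_norm f = (\<Sum>n. (1 + real n) * (\<bar>fourier_cos f n\<bar> + \<bar>fourier_sin f n\<bar>))"

lemma fourier_coeff_nat_eq:
  assumes "continuous_on UNIV f"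
  shows "fourier_coeff f (int n) =
    Complex (integral {-pi..pi} (\<lambda>y. f y * cos (real n * y)) / (2 * pi))
      (- integral {-pi..pi} (\<lambda>y. f y * sin (real n * y)) / (2 * pi))"
proof -
  note cf = continuous_on_subset[OF assms subset_UNIV]
  define J where "J = integral {-pi..pi} (\<lambda>x. complex_of_real (f x) * cis (- (of_int (int n) * x)))"
  have J: "((\<lambda>x. complex_of_real (f x) * cis (- (of_int (int n) * x))) has_integral J) {-pi..pi}"
    unfolding J_def by (intro integrable_integral integrable_continuous_real continuous_intros cf)
  have "((\<lambda>y. f y * cos (real n * y)) has_integral Re J) {-pi..pi}"
    using has_integral_linear[OF J bounded_linear_Re] by (simp add: o_def)
  moreover have "((\<lambda>y. f y * sin (real n * y)) has_integral - Im J) {-pi..pi}"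
    using has_integral_neg[OF has_integral_linear[OF J bounded_linear_Im]] by (simp add: o_def)
  ultimately have "Re J = integral {-pi..pi} (\<lambda>y. f y * cos (real n * y))"
    "Im J = - integral {-pi..pi} (\<lambda>y. f y * sin (real n * y))"
    by (simp_all add: integral_unique)
  then show ?thesis by (simp add: fourier_coeff_def J_def complex_eq_iff Re_divide Im_divide power2_eq_square)
qed

lemma abs_fourier_cos_sin_le:
  assumes "continuous_on UNIV f"
  shows "\<bar>fourier_cos f n\<bar> \<le> 2 * cmod (fourier_coeff f (int n))"
    and "\<bar>fourier_sin f n\<bar> \<le> 2 * cmod (fourier_coeff f (int n))"
proof -
  define z where "z = fourier_coeff f (int n)"
  have z: "fourier_cos f n = (if n = 0 then 1 else 2) * Re z" "fourier_sin f n = (if n = 0 then 1 else 2) * - Im z"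
    by (simp_all add: z_def fourier_coeff_nat_eq[OF assms] fourier_cos_def fourier_sin_def)
  have "\<bar>Re z\<bar> \<le> cmod z" "\<bar>Im z\<bar> \<le> cmod z" by (simp_all add: abs_Re_le_cmod abs_Im_le_cmod)
  then show "\<bar>fourier_cos f n\<bar> \<le> 2 * cmod (fourier_coeff f (int n))"
    and "\<bar>fourier_sin f n\<bar> \<le> 2 * cmod (fourier_coeff f (int n))"
    unfolding z z_def[symmetric] by (auto simp: abs_mult)
qed

text \<open>The ratios decay like 1/n. They are the second factor in the Cauchy-Schwarz estimate for
  Sobolev coefficients.\<close>

lemma summable_sobolev_weights: "summable (\<lambda>n. ((1 + real n) / (1 + (real n)\<^sup>2))\<^sup>2)"
proof (rule summable_comparison_test')
  show "summable (\<lambda>n. 4 * inverse (real n ^ 2))"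
    by (intro summable_mult inverse_power_summable) simp
  fix n :: nat assume n: "1 \<le> n"
  have "(1 + real n) / (1 + (real n)\<^sup>2) \<le> (2 * real n) / (real n)\<^sup>2"
    using n by (intro frac_le) auto
  also have "\<dots> = 2 / real n" using n by (simp add: power2_eq_square)
  finally have "((1 + real n) / (1 + (real n)\<^sup>2))\<^sup>2 \<le> (2 / real n)\<^sup>2" by (intro power_mono) auto
  then show "norm (((1 + real n) / (1 + (real n)\<^sup>2))\<^sup>2) \<le> 4 * inverse (real n ^ 2)"
    by (simp add: power_divide power_inverse flip: divide_inverse)
qed

text \<open>Cauchy-Schwarz: with c_n the modulus of the n-th coefficient and q_n the ratio above, (1
  + n) c_n = q_n (1 + n^2) c_n, and (1 + n^2) c_n is at most the square root of the Sobolev weight.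
  The norm bound transfers continuity in time from \<open>Hk\<close> to
  \<open>wiener_norm\<close>.\<close>

lemma Hk_trig_summable:
  assumes "f \<in> Hk k" "2 \<le> k"
  shows "trig_summable (fourier_cos f) (fourier_sin f)"
    and "wiener_norm f \<le> 4 * sqrt (\<Sum>n. ((1 + real n) / (1 + (real n)\<^sup>2))\<^sup>2) * Hk_norm k f"
proof -
  define q where "q n = (1 + real n) / (1 + (real n)\<^sup>2)" for n
  define w where "w n = Hk_weight k f (int n)" for n
  define t where "t n = (1 + real n) * (\<bar>fourier_cos f n\<bar> + \<bar>fourier_sin f n\<bar>)" for n
  have cf: "continuous_on UNIV f" and sw: "Hk_weight k f summable_on UNIV" using assms by (auto simp: Hk_def)
  have w0: "0 \<le> Hk_weight k f n" for n by (simp add: Hk_weight_def)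
  have t: "t n \<le> 4 * (\<bar>sqrt (w n)\<bar> * \<bar>q n\<bar>)" for n
  proof -
    define c where "c = cmod (fourier_coeff f (int n))"
    define g where "g = 1 + (real n)\<^sup>2"
    have g: "1 \<le> g" by (simp add: g_def)
    \<comment> \<open>Here k >= 2 enters: g^2 <= g^k for g >= 1.\<close>
    then have "(g * c)\<^sup>2 \<le> g ^ k * c\<^sup>2"
      unfolding power_mult_distrib using assms(2) by (intro mult_right_mono power_increasing) auto
    also have "\<dots> = w n" by (simp add: w_def Hk_weight_def g_def c_def)
    finally have "g * c \<le> sqrt (w n)" by (rule real_le_rsqrt)
    then have "g * c * q n \<le> sqrt (w n) * q n" by (rule mult_right_mono) (simp add: q_def)
    moreover have "g * c * q n = (1 + real n) * c" using g by (simp add: q_def flip: g_def)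
    moreover have "t n \<le> (1 + real n) * (2 * c + 2 * c)"
      unfolding t_def c_def by (intro mult_left_mono add_mono abs_fourier_cos_sin_le cf) auto
    moreover have "\<bar>sqrt (w n)\<bar> = sqrt (w n)" "\<bar>q n\<bar> = q n" by (simp_all add: q_def w_def w0)
    ultimately show ?thesis by (simp add: algebra_simps)
  qed
  have bd: "(\<Sum>n<N. t n) \<le> 4 * sqrt (\<Sum>n. (q n)\<^sup>2) * Hk_norm k f" for N
  proof -
    have "(\<Sum>n<N. t n) \<le> 4 * (\<Sum>n<N. \<bar>sqrt (w n)\<bar> * \<bar>q n\<bar>)"
      unfolding sum_distrib_left by (intro sum_mono t)
    also have "\<dots> \<le> 4 * (L2_set (\<lambda>n. sqrt (w n)) {..<N} * L2_set q {..<N})"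
      by (intro mult_left_mono L2_set_mult_ineq) auto
    also have "\<dots> \<le> 4 * (Hk_norm k f * sqrt (\<Sum>n. (q n)\<^sup>2))"
    proof (intro mult_left_mono mult_mono)
      have "(\<Sum>n<N. w n) = sum (Hk_weight k f) (int ` {..<N})"
        by (simp add: sum.reindex w_def)
      also have "\<dots> \<le> (\<Sum>\<^sub>\<infinity>n. Hk_weight k f n)"
        by (intro finite_sum_le_infsum sw w0) auto
      finally show "L2_set (\<lambda>n. sqrt (w n)) {..<N} \<le> Hk_norm k f"
        by (simp add: L2_set_def Hk_norm_def w_def w0)
      show "L2_set q {..<N} \<le> sqrt (\<Sum>n. (q n)\<^sup>2)"
        unfolding L2_set_def using summable_sobolev_weights
        by (intro real_sqrt_le_mono sum_le_suminf) (auto simp: q_def)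
      show "0 \<le> Hk_norm k f" by (simp add: Hk_norm_def infsum_nonneg w0)
    qed (auto intro: L2_set_nonneg)
    finally show ?thesis by (simp add: mult_ac)
  qed
  have st: "summable t" by (rule summableI_nonneg_bounded[OF _ bd]) (simp add: t_def)
  then show "trig_summable (fourier_cos f) (fourier_sin f)" by (simp add: trig_summable_def t_def[abs_def])
  show "wiener_norm f \<le> 4 * sqrt (\<Sum>n. ((1 + real n) / (1 + (real n)\<^sup>2))\<^sup>2) * Hk_norm k f"
    using suminf_le_const[OF st bd] by (simp only: wiener_norm_def t_def q_def)
qed

lemma fourier_coeff_diff:
  assumes "continuous_on UNIV f" "continuous_on UNIV g"
  shows "fourier_coeff (\<lambda>x. f x - g x) n = fourier_coeff f n - fourier_coeff g n"
proof -
  have "(\<lambda>x. complex_of_real (h x) * cis (- (of_int n * x))) integrable_on {-pi..pi}"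
    if "continuous_on UNIV h" for h
    by (intro integrable_continuous_real continuous_intros continuous_on_subset[OF that subset_UNIV])
  then show ?thesis
    using integral_diff[of "\<lambda>x. complex_of_real (f x) * cis (- (of_int n * x))" "{-pi..pi}"
        "\<lambda>x. complex_of_real (g x) * cis (- (of_int n * x))"] assms
    by (simp add: fourier_coeff_def left_diff_distrib right_diff_distrib diff_divide_distrib)
qed

lemma fourier_cos_sin_diff:
  assumes "continuous_on UNIV f" "continuous_on UNIV g"
  shows "fourier_cos (\<lambda>x. f x - g x) n = fourier_cos f n - fourier_cos g n"
    and "fourier_sin (\<lambda>x. f x - g x) n = fourier_sin f n - fourier_sin g n"
proof -
  have i: "(\<lambda>x. h x * cos (real n * x)) integrable_on {-pi..pi}" "(\<lambda>x. h x * sin (real n * x)) integrable_on {-pi..pi}"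
    if "continuous_on UNIV h" for h
    by (intro integrable_continuous_real continuous_intros continuous_on_subset[OF that subset_UNIV])+
  show "fourier_cos (\<lambda>x. f x - g x) n = fourier_cos f n - fourier_cos g n"
    using integral_diff[OF i(1)[OF assms(1)] i(1)[OF assms(2)]]
    by (simp add: fourier_cos_def left_diff_distrib right_diff_distrib diff_divide_distrib)
  show "fourier_sin (\<lambda>x. f x - g x) n = fourier_sin f n - fourier_sin g n"
    using integral_diff[OF i(2)[OF assms(1)] i(2)[OF assms(2)]]
    by (simp add: fourier_sin_def left_diff_distrib right_diff_distrib diff_divide_distrib)
qed

lemma Hk_diff:
  assumes "f \<in> Hk k" "g \<in> Hk k"
  shows "(\<lambda>x. f x - g x) \<in> Hk k"
proof -
  have c: "continuous_on UNIV f" "continuous_on UNIV g" using assms by (auto simp: Hk_def)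
  have "(\<lambda>n. 2 * Hk_weight k f n + 2 * Hk_weight k g n) summable_on UNIV"
    using assms by (intro summable_on_add summable_on_cmult_right) (auto simp: Hk_def)
  moreover have "Hk_weight k (\<lambda>x. f x - g x) n \<le> 2 * Hk_weight k f n + 2 * Hk_weight k g n" for n
  proof -
    define z w where "z = fourier_coeff f n" "w = fourier_coeff g n"
    have "(cmod (z - w))\<^sup>2 \<le> (cmod z + cmod w)\<^sup>2" by (intro power_mono norm_triangle_ineq4) auto
    also have "\<dots> \<le> 2 * (cmod z)\<^sup>2 + 2 * (cmod w)\<^sup>2"
      using zero_le_power2[of "cmod z - cmod w"] by (simp add: power2_eq_square algebra_simps)
    finally have "(1 + (real_of_int n)\<^sup>2) ^ k * (cmod (z - w))\<^sup>2 \<le>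
        (1 + (real_of_int n)\<^sup>2) ^ k * (2 * (cmod z)\<^sup>2 + 2 * (cmod w)\<^sup>2)"
      by (intro mult_left_mono) auto
    then show ?thesis by (simp add: Hk_weight_def fourier_coeff_diff[OF c] z_w_def algebra_simps)
  qed
  ultimately have "Hk_weight k (\<lambda>x. f x - g x) summable_on UNIV"
    by (rule summable_on_comparison_test) (auto simp: Hk_weight_def)
  then show ?thesis using assms by (auto simp: Hk_def periodic_def intro: continuous_intros)
qed

section \<open>The Wiener-type class that replaces the Sobolev space\<close>

text \<open>This class does not mention k, which keeps all pointwise estimates below independent of
  the Sobolev exponent.\<close>

definition wiener :: "(real \<Rightarrow> real) set" where
  "wiener = {f. periodic f \<and> continuous_on UNIV f \<and> trig_summable (fourier_cos f) (fourier_sin f)}"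

lemma Hk_subset_wiener: "2 \<le> k \<Longrightarrow> Hk k \<subseteq> wiener"
  using Hk_trig_summable(1) by (auto simp: wiener_def Hk_def)

lemma wienerD:
  assumes "f \<in> wiener"
  shows "periodic f" "continuous_on UNIV f" "trig_summable (fourier_cos f) (fourier_sin f)"
  using assms by (auto simp: wiener_def)

lemma wiener_norm_triangle:
  assumes "f \<in> wiener" "g \<in> wiener" "(\<lambda>x. f x - g x) \<in> wiener"
  shows "wiener_norm f \<le> wiener_norm g + wiener_norm (\<lambda>x. f x - g x)"
proof -
  note s = wienerD(3)[OF assms(1), unfolded trig_summable_def] wienerD(3)[OF assms(2), unfolded trig_summable_def]
    wienerD(3)[OF assms(3), unfolded trig_summable_def]
  have "wiener_norm f \<le> (\<Sum>n. (1 + real n) * (\<bar>fourier_cos g n\<bar> + \<bar>fourier_sin g n\<bar>) +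
      (1 + real n) * (\<bar>fourier_cos (\<lambda>x. f x - g x) n\<bar> + \<bar>fourier_sin (\<lambda>x. f x - g x) n\<bar>))"
    unfolding wiener_norm_def
  proof (intro suminf_le s summable_add)
    fix n
    show "(1 + real n) * (\<bar>fourier_cos f n\<bar> + \<bar>fourier_sin f n\<bar>) \<le>
        (1 + real n) * (\<bar>fourier_cos g n\<bar> + \<bar>fourier_sin g n\<bar>) +
        (1 + real n) * (\<bar>fourier_cos (\<lambda>x. f x - g x) n\<bar> + \<bar>fourier_sin (\<lambda>x. f x - g x) n\<bar>)"
      unfolding distrib_left[symmetric]
        fourier_cos_sin_diff[OF wienerD(2)[OF assms(1)] wienerD(2)[OF assms(2)]]
      by (intro mult_left_mono) auto
  qed
  also have "\<dots> = wiener_norm g + wiener_norm (\<lambda>x. f x - g x)"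
    unfolding wiener_norm_def by (rule suminf_add[symmetric]) (rule s)+
  finally show ?thesis .
qed

text \<open>Every series here has coefficients dominated termwise by (1 + n) (|a_n| + |b_n|). The
  third and fourth are f' and the derivative of H f; the last bound controls the mass.\<close>

lemma wiener_bounds:
  assumes "f \<in> wiener"
  defines "a \<equiv> fourier_cos f" and "b \<equiv> fourier_sin f"
  shows "\<bar>f x\<bar> \<le> wiener_norm f" "\<bar>hilbert f x\<bar> \<le> wiener_norm f"
    and "\<bar>trig_series (\<lambda>n. real n * b n) (\<lambda>n. - real n * a n) x\<bar> \<le> wiener_norm f"
    and "\<bar>trig_series (\<lambda>n. real n * a n) (\<lambda>n. real n * b n) x\<bar> \<le> wiener_norm f"
    and "\<bar>a 0\<bar> \<le> wiener_norm f"
proof -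
  note w = wienerD[OF assms(1)]
  note ts = w(3)[unfolded trig_summable_def, folded a_def b_def]
  note sm = trig_summableD[OF w(3), folded a_def b_def]
  have main: "\<bar>trig_series c d x\<bar> \<le> wiener_norm f"
    if "\<And>n. \<bar>c n\<bar> + \<bar>d n\<bar> \<le> (1 + real n) * (\<bar>a n\<bar> + \<bar>b n\<bar>)" for c d
  proof -
    have s: "summable (\<lambda>n. \<bar>c n\<bar> + \<bar>d n\<bar>)"
      by (rule summable_comparison_test'[OF ts, of 0]) (use that in auto)
    show ?thesis
      using abs_trig_series_le[OF s, of x] suminf_le[OF that s ts] by (simp add: wiener_norm_def a_def b_def)
  qed
  have "f x = trig_series a b x" using fourier_inversion[OF w(1,2)] sm(1) by (simp add: a_def b_def)
  also have "\<bar>\<dots>\<bar> \<le> wiener_norm f" by (rule main) (simp add: algebra_simps)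
  finally show "\<bar>f x\<bar> \<le> wiener_norm f" .
  show "\<bar>hilbert f x\<bar> \<le> wiener_norm f"
    unfolding hilbert_eq_trig_series[OF w] a_def[symmetric] b_def[symmetric]
    by (rule main) (simp add: algebra_simps)
  show "\<bar>trig_series (\<lambda>n. real n * b n) (\<lambda>n. - real n * a n) x\<bar> \<le> wiener_norm f"
    by (rule main) (simp add: abs_mult algebra_simps)
  show "\<bar>trig_series (\<lambda>n. real n * a n) (\<lambda>n. real n * b n) x\<bar> \<le> wiener_norm f"
    by (rule main) (simp add: abs_mult algebra_simps)
  have "(\<Sum>n\<in>{0}. (1 + real n) * (\<bar>a n\<bar> + \<bar>b n\<bar>)) \<le> wiener_norm f"
    unfolding wiener_norm_def a_def[symmetric] b_def[symmetric] by (intro sum_le_suminf ts) auto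
  then show "\<bar>a 0\<bar> \<le> wiener_norm f" by simp
qed

lemma wiener_has_real_derivative:
  assumes "f \<in> wiener"
  shows "(f has_real_derivative
    trig_series (\<lambda>n. real n * fourier_sin f n) (\<lambda>n. - real n * fourier_cos f n) x) (at x)"
proof -
  note w = wienerD[OF assms]
  have "f = trig_series (fourier_cos f) (fourier_sin f)"
    using fourier_inversion[OF w(1,2)] trig_summableD(1)[OF w(3)] by auto
  then show ?thesis
    using trig_series_has_real_derivative[OF trig_summableD[OF w(3)], of x] by simp
qed

section \<open>The flux\<close>

lemma C_on_derivative:
  assumes "C_on m {0..} \<beta>" "2 \<le> m"
  obtains \<beta>' where "\<And>y. 0 \<le> y \<Longrightarrow> (\<beta> has_real_derivative \<beta>' y) (at y within {0..})"
    "continuous_on {0..} \<beta>'"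
proof -
  obtain D where D: "\<forall>y\<in>{0..}. D 0 y = \<beta> y"
    "\<forall>i<m. \<forall>y\<in>{0..}. (D i has_real_derivative D (Suc i) y) (at y within {0..})"
    using assms(1) unfolding C_on_def by blast
  have "(\<beta> has_real_derivative D (Suc 0) y) (at y within {0..})" if "0 \<le> y" for y
    using D(2)[rule_format, of 0 y] that assms(2) D(1)
    by (auto intro: has_field_derivative_transform_within[of _ _ _ _ 1])
  moreover have "continuous_on {0..} (D (Suc 0))"
    using D(2)[rule_format, of "Suc 0"] assms(2) by (intro DERIV_continuous_on[where D = "D 2"])
      (auto simp: numeral_2_eq_2)
  ultimately show ?thesis using that by blast
qed

text \<open>Periodicity of v and Rolle's theorem give a zero of v' inside the period; v'' is bounded
  by B, and no point of the period is further than 2 pi from that zero.\<close>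

lemma abs_deriv_potential_le:
  assumes "is_potential f v" "\<And>x. \<bar>f x - mean f\<bar> \<le> B" "x \<in> {-pi..pi}"
  shows "\<bar>deriv v x\<bar> \<le> 2 * pi * B"
proof -
  have d: "(v has_real_derivative deriv v y) (at y)"
    "(deriv v has_real_derivative (f y - mean f)) (at y)" for y
    using assms(1) unfolding is_potential_def
    by (auto simp: DERIV_deriv_iff_real_differentiable)
  have "v (- pi + 2 * pi) = v (- pi)" using assms(1) unfolding is_potential_def periodic_def by blast
  then have "v (- pi) = v pi" by simp
  then obtain \<xi> where \<xi>: "-pi < \<xi>" "\<xi> < pi" "(v has_real_derivative 0) (at \<xi>)"
    using Rolle[of "-pi" pi v] d(1) DERIV_isCont real_differentiable_def
    by (metis (no_types, lifting) continuous_at_imp_continuous_on neg_less_pos pi_gt_zero)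
  have "\<bar>deriv v x - deriv v \<xi>\<bar> \<le> B * \<bar>x - \<xi>\<bar>"
    using field_differentiable_bound[of "{-pi..pi}" "deriv v" "\<lambda>y. f y - mean f" B x \<xi>] d(2) assms(2,3) \<xi>
    by (auto intro: has_field_derivative_at_within)
  moreover have "deriv v \<xi> = 0" using DERIV_unique[OF d(1) \<xi>(3)] .
  moreover have "0 \<le> B" using assms(2)[of 0] by linarith
  then have "B * \<bar>x - \<xi>\<bar> \<le> B * (2 * pi)" using assms(3) \<xi> by (intro mult_left_mono) auto
  ultimately show ?thesis by (simp add: mult_ac)
qed

lemma abs_mean_le:
  assumes "continuous_on UNIV f" "\<And>x. \<bar>f x\<bar> \<le> B"
  shows "\<bar>mean f\<bar> \<le> B"
proof -
  have i: "f integrable_on {-pi..pi}"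
    by (intro integrable_continuous_real continuous_on_subset[OF assms(1)]) auto
  have "norm (integral {-pi..pi} f) \<le> integral {-pi..pi} (\<lambda>_. B)"
    by (rule integral_norm_bound_integral[OF i]) (use assms(2) in auto)
  then show ?thesis by (simp add: mean_def abs_mult field_simps)
qed

lemma flux_has_real_derivative:
  assumes f: "f \<in> wiener" "\<And>x. 0 \<le> f x" and v: "is_potential f v"
    and \<beta>: "\<And>y. 0 \<le> y \<Longrightarrow> (\<beta> has_real_derivative \<beta>' y) (at y within {0..})"
  defines "f' \<equiv> trig_series (\<lambda>n. real n * fourier_sin f n) (\<lambda>n. - real n * fourier_cos f n)"
    and "L \<equiv> trig_series (\<lambda>n. real n * fourier_cos f n) (\<lambda>n. real n * fourier_sin f n)"
  shows "(flux \<beta> f v has_real_derivative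
      - (\<beta>' (f x) * f' x * hilbert f x) - \<beta> (f x) * L x + f' x * deriv v x + f x * (f x - mean f)) (at x)"
proof -
  have df: "(f has_real_derivative f' x) (at x)"
    unfolding f'_def by (rule wiener_has_real_derivative[OF f(1)])
  \<comment> \<open>\<beta> is differentiable only within [0, \<infinity>), one-sidedly at 0. Taking
    its derivative within the range of f makes the chain rule valid also where f vanishes.\<close>
  have "range f \<subseteq> {0..}" using f(2) by auto
  then have "(\<beta> has_real_derivative \<beta>' (f x)) (at (f x) within range f)"
    using \<beta>[OF f(2)[of x]] has_field_derivative_subset by blast
  from DERIV_image_chain[OF this df] have db: "((\<lambda>x. \<beta> (f x)) has_real_derivative \<beta>' (f x) * f' x) (at x)"
    by (simp add: o_def)
  have dh: "(hilbert f has_real_derivative L x) (at x)"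
    unfolding L_def by (rule hilbert_has_real_derivative[OF wienerD[OF f(1)]])
  have dv: "(deriv v has_real_derivative f x - mean f) (at x)"
    using v by (simp add: is_potential_def)
  have "((\<lambda>x. - \<beta> (f x) * hilbert f x + f x * deriv v x) has_real_derivative
      - (\<beta>' (f x) * f' x * hilbert f x) - \<beta> (f x) * L x + f' x * deriv v x + f x * (f x - mean f)) (at x)"
    by (rule derivative_eq_intros db dh dv df refl)+ (simp add: algebra_simps)
  then show ?thesis by (simp add: flux_def[abs_def])
qed

section \<open>Conservation of mass\<close>

lemma solution_on_subset:
  assumes "solution_on k \<beta> \<rho>\<^sub>0 I \<rho>" "J \<subseteq> I"
  shows "solution_on k \<beta> \<rho>\<^sub>0 J \<rho>"
proof -
  obtain v where v: "\<forall>t\<in>I. is_potential (\<rho> t) (v t)"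
    "\<forall>t\<in>I. 0 < t \<longrightarrow> (\<forall>x. \<exists>d. ((\<lambda>s. \<rho> s x) has_real_derivative d) (at t within I) \<and>
       (flux \<beta> (\<rho> t) (v t) has_real_derivative d) (at x))"
    using assms(1) unfolding solution_on_def by blast
  have "\<forall>t\<in>J. 0 < t \<longrightarrow> (\<forall>x. \<exists>d. ((\<lambda>s. \<rho> s x) has_real_derivative d) (at t within J) \<and>
       (flux \<beta> (\<rho> t) (v t) has_real_derivative d) (at x))"
    using v(2) assms(2) has_field_derivative_subset by (meson subsetD)
  moreover have "continuous_in_Hk k J \<rho>"
    using assms unfolding solution_on_def continuous_in_Hk_def
    by (meson subsetD tendsto_within_subset)
  ultimately show ?thesis
    using assms v(1) unfolding solution_on_def by blast
qed

lemma wiener_norm_nonneg: "f \<in> wiener \<Longrightarrow> 0 \<le> wiener_norm f"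
  using wiener_bounds(1)[of f 0] by linarith

text \<open>From here on, continuity in time is used in \<open>wiener_norm\<close>, which controls
  differences uniformly in x.\<close>

lemma continuous_in_Hk_wiener:
  assumes "continuous_in_Hk k I \<rho>" "2 \<le> k"
  shows "\<And>t. t \<in> I \<Longrightarrow> \<rho> t \<in> wiener"
    and "\<And>s t. s \<in> I \<Longrightarrow> t \<in> I \<Longrightarrow> (\<lambda>x. \<rho> t x - \<rho> s x) \<in> wiener"
    and "\<And>s. s \<in> I \<Longrightarrow> ((\<lambda>t. wiener_norm (\<lambda>x. \<rho> t x - \<rho> s x)) \<longlongrightarrow> 0) (at s within I)"
proof -
  have Hk: "\<rho> t \<in> Hk k" if "t \<in> I" for t using assms that by (auto simp: continuous_in_Hk_def)
  show w: "\<rho> t \<in> wiener" if "t \<in> I" for t using Hk[OF that] Hk_subset_wiener[OF assms(2)] by blast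
  show wd: "(\<lambda>x. \<rho> t x - \<rho> s x) \<in> wiener" if "s \<in> I" "t \<in> I" for s t
    using Hk_diff[OF Hk Hk] that Hk_subset_wiener[OF assms(2)] by blast
  show "((\<lambda>t. wiener_norm (\<lambda>x. \<rho> t x - \<rho> s x)) \<longlongrightarrow> 0) (at s within I)" if s: "s \<in> I" for s
  proof -
    define A where "A = 4 * sqrt (\<Sum>n. ((1 + real n) / (1 + (real n)\<^sup>2))\<^sup>2)"
    have lim: "((\<lambda>t. A * Hk_norm k (\<lambda>x. \<rho> t x - \<rho> s x)) \<longlongrightarrow> A * 0) (at s within I)"
      using assms(1) s by (intro tendsto_intros) (auto simp: continuous_in_Hk_def)
    have ev: "\<forall>\<^sub>F t in at s within I. t \<in> I" by (simp add: eventually_at_filter)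
    show ?thesis
    proof (rule tendsto_sandwich[OF _ _ tendsto_const])
      show "((\<lambda>t. A * Hk_norm k (\<lambda>x. \<rho> t x - \<rho> s x)) \<longlongrightarrow> 0) (at s within I)" using lim by simp
      show "\<forall>\<^sub>F t in at s within I. 0 \<le> wiener_norm (\<lambda>x. \<rho> t x - \<rho> s x)"
        using ev by eventually_elim (rule wiener_norm_nonneg[OF wd[OF s]])
      show "\<forall>\<^sub>F t in at s within I. wiener_norm (\<lambda>x. \<rho> t x - \<rho> s x) \<le> A * Hk_norm k (\<lambda>x. \<rho> t x - \<rho> s x)"
        using ev by eventually_elim
          (use Hk_trig_summable(2)[OF Hk_diff[OF Hk Hk[OF s]] assms(2)] in \<open>simp add: A_def\<close>)
    qed
  qed
qed

lemma continuous_on_of_wiener_bound: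
  fixes g :: "real \<Rightarrow> real"
  assumes "continuous_in_Hk k I \<rho>" "2 \<le> k"
    and "\<And>s t. s \<in> I \<Longrightarrow> t \<in> I \<Longrightarrow> \<bar>g t - g s\<bar> \<le> c * wiener_norm (\<lambda>x. \<rho> t x - \<rho> s x)"
  shows "continuous_on I g"
  unfolding continuous_on_def
proof
  fix s assume s: "s \<in> I"
  have ev: "\<forall>\<^sub>F t in at s within I. t \<in> I" by (simp add: eventually_at_filter)
  have "((\<lambda>t. c * wiener_norm (\<lambda>x. \<rho> t x - \<rho> s x)) \<longlongrightarrow> c * 0) (at s within I)"
    by (intro tendsto_intros continuous_in_Hk_wiener(3)[OF assms(1,2) s])
  moreover have "\<forall>\<^sub>F t in at s within I. norm (g t - g s) \<le> c * wiener_norm (\<lambda>x. \<rho> t x - \<rho> s x)"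
    using ev by eventually_elim (simp add: assms(3)[OF s])
  ultimately have "((\<lambda>t. g t - g s) \<longlongrightarrow> 0) (at s within I)"
    by (simp add: Lim_null_comparison)
  then show "(g \<longlongrightarrow> g s) (at s within I)" by (rule LIM_zero_cancel)
qed

lemma integral_eq_fourier_cos: "integral {-pi..pi} f = 2 * pi * fourier_cos f 0"
  by (simp add: fourier_cos_def)

lemma flux_ends_eq:
  assumes "f \<in> wiener" "is_potential f v"
  shows "flux \<beta> f v pi = flux \<beta> f v (- pi)"
proof -
  have "f (- pi + 2 * pi) = f (- pi)" using wienerD(1)[OF assms(1)] unfolding periodic_def by blast
  moreover have "deriv v pi = deriv v (- pi)"
  proof -
    have "(v has_real_derivative deriv v pi) (at (- pi + 2 * pi))"
      using assms(2) by (simp add: is_potential_def DERIV_deriv_iff_real_differentiable)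
    then have "((\<lambda>x. v (x + 2 * pi)) has_real_derivative deriv v pi) (at (- pi))"
      by (simp only: DERIV_shift)
    then have "(v has_real_derivative deriv v pi) (at (- pi))"
      using assms(2) by (simp add: is_potential_def periodic_def)
    then show ?thesis using DERIV_imp_deriv by metis
  qed
  ultimately show ?thesis
    using hilbert_periodic[OF wienerD[OF assms(1)]] by (simp add: flux_def)
qed

text \<open>Along a solution d is the time derivative of the density. A bound uniform over all
  states with \<open>wiener_norm\<close> at most N supplies the dominating function for
  differentiating the mass.\<close>

lemma flux_derivative_bounded:
  assumes "C_on 4 {0..} \<beta>"
  obtains E where "\<And>f v d x. \<lbrakk>f \<in> wiener; \<And>x. 0 \<le> f x; wiener_norm f \<le> N; is_potential f v;
     x \<in> {-pi..pi}; (flux \<beta> f v has_real_derivative d) (at x)\<rbrakk> \<Longrightarrow> \<bar>d\<bar> \<le> E"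
proof -
  obtain \<beta>' where \<beta>': "\<And>y. 0 \<le> y \<Longrightarrow> (\<beta> has_real_derivative \<beta>' y) (at y within {0..})" "continuous_on {0..} \<beta>'"
    using C_on_derivative[OF assms] by auto
  have c\<beta>: "continuous_on {0..} \<beta>" using \<beta>'(1) by (intro DERIV_continuous_on) auto
  have bdd: "\<exists>K\<ge>0. \<forall>y\<in>{0..N}. \<bar>g y\<bar> \<le> K" if "continuous_on {0..} g" for g :: "real \<Rightarrow> real"
  proof -
    have "compact (g ` {0..N})"
      by (intro compact_continuous_image continuous_on_subset[OF that]) auto
    then obtain K where "0 < K" "\<forall>z\<in>g ` {0..N}. \<bar>z\<bar> \<le> K"
      using compact_imp_bounded bounded_pos by (metis real_norm_def)
    then show ?thesis by (intro exI[of _ K]) auto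
  qed
  obtain K where K: "0 \<le> K" "\<And>y. y \<in> {0..N} \<Longrightarrow> \<bar>\<beta> y\<bar> \<le> K" using bdd[OF c\<beta>] by blast
  obtain K' where K': "0 \<le> K'" "\<And>y. y \<in> {0..N} \<Longrightarrow> \<bar>\<beta>' y\<bar> \<le> K'" using bdd[OF \<beta>'(2)] by blast
  show ?thesis
  proof (rule that)
    fix f v d x
    assume f: "f \<in> wiener" "\<And>x. 0 \<le> f x" "wiener_norm f \<le> N" and v: "is_potential f v"
      and x: "x \<in> {-pi..pi}" and d: "(flux \<beta> f v has_real_derivative d) (at x)"
    define f' where "f' = trig_series (\<lambda>n. real n * fourier_sin f n) (\<lambda>n. - real n * fourier_cos f n) x"
    define L where "L = trig_series (\<lambda>n. real n * fourier_cos f n) (\<lambda>n. real n * fourier_sin f n) x"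
    have b: "\<bar>f x\<bar> \<le> N" "\<bar>hilbert f x\<bar> \<le> N" "\<bar>f'\<bar> \<le> N" "\<bar>L\<bar> \<le> N" for x
      using wiener_bounds[OF f(1)] f(3) unfolding f'_def L_def by (meson order_trans)+
    have N: "0 \<le> N" using b(1)[of 0] by linarith
    have fx: "f x \<in> {0..N}" using f(2)[of x] b(1)[of x] by auto
    have m: "\<bar>f y - mean f\<bar> \<le> 2 * N" for y
      using b(1)[of y] abs_mean_le[OF wienerD(2)[OF f(1)] b(1)] by linarith
    have dv: "\<bar>deriv v x\<bar> \<le> 2 * pi * (2 * N)" by (rule abs_deriv_potential_le[OF v m x])
    have "d = - (\<beta>' (f x) * f' * hilbert f x) - \<beta> (f x) * L + f' * deriv v x + f x * (f x - mean f)"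
      unfolding f'_def L_def by (rule DERIV_unique[OF d flux_has_real_derivative[OF f(1,2) v \<beta>'(1)]])
    moreover have "\<bar>\<beta>' (f x) * f' * hilbert f x\<bar> \<le> K' * N * N"
      unfolding abs_mult by (intro mult_mono K' b fx mult_nonneg_nonneg N) auto
    moreover have "\<bar>\<beta> (f x) * L\<bar> \<le> K * N" unfolding abs_mult by (intro mult_mono K b fx) auto
    moreover have "\<bar>f' * deriv v x\<bar> \<le> N * (2 * pi * (2 * N))"
      unfolding abs_mult by (intro mult_mono b dv N) auto
    moreover have "\<bar>f x * (f x - mean f)\<bar> \<le> N * (2 * N)"
      unfolding abs_mult by (intro mult_mono b m N) auto
    ultimately show "\<bar>d\<bar> \<le> K' * N * N + K * N + N * (2 * pi * (2 * N)) + N * (2 * N)"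
      by linarith
  qed
qed

text \<open>Difference quotients of the density in time are dominated by a constant, so the mass has
  derivative equal to the integral of the flux derivative over a period, which is 0 by periodicity
  of the flux. Continuity extends the conclusion to the endpoints of the time interval.\<close>

lemma solution_mass_conserved:
  assumes sol: "solution_on k \<beta> \<rho>\<^sub>0 {0..T} \<rho>" and k: "2 \<le> k" and \<beta>: "C_on 4 {0..} \<beta>"
    and t: "t \<in> {0..T}"
  shows "integral {-pi..pi} (\<rho> t) = integral {-pi..pi} (\<rho> 0)"
proof (cases "T = 0")
  case False
  then have T: "0 < T" using t by auto
  have cont: "continuous_in_Hk k {0..T} \<rho>" and nonneg: "\<And>t x. t \<in> {0..T} \<Longrightarrow> 0 \<le> \<rho> t x"
    using sol by (auto simp: solution_on_def)
  note W = continuous_in_Hk_wiener[OF cont k]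
  obtain v where v: "\<And>t. t \<in> {0..T} \<Longrightarrow> is_potential (\<rho> t) (v t)"
    and ex: "\<And>t x. t \<in> {0..T} \<Longrightarrow> 0 < t \<Longrightarrow>
       \<exists>d. ((\<lambda>s. \<rho> s x) has_real_derivative d) (at t within {0..T}) \<and>
           (flux \<beta> (\<rho> t) (v t) has_real_derivative d) (at x)"
    using sol unfolding solution_on_def by blast
  then obtain d where d: "\<And>t x. t \<in> {0..T} \<Longrightarrow> 0 < t \<Longrightarrow> ((\<lambda>s. \<rho> s x) has_real_derivative d t x) (at t within {0..T})"
    "\<And>t x. t \<in> {0..T} \<Longrightarrow> 0 < t \<Longrightarrow> (flux \<beta> (\<rho> t) (v t) has_real_derivative d t x) (at x)"
    by metis

  have "continuous_on {0..T} (\<lambda>t. wiener_norm (\<rho> t))"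
  proof (rule continuous_on_of_wiener_bound[OF cont k, where c = 1])
    fix s t assume st: "s \<in> {0..T}" "t \<in> {0..T}"
    have eq: "wiener_norm (\<lambda>x. \<rho> s x - \<rho> t x) = wiener_norm (\<lambda>x. \<rho> t x - \<rho> s x)"
      unfolding wiener_norm_def
        fourier_cos_sin_diff[OF wienerD(2)[OF W(1)[OF st(1)]] wienerD(2)[OF W(1)[OF st(2)]]]
        fourier_cos_sin_diff[OF wienerD(2)[OF W(1)[OF st(2)]] wienerD(2)[OF W(1)[OF st(1)]]]
      by (simp add: abs_minus_commute)
    show "\<bar>wiener_norm (\<rho> t) - wiener_norm (\<rho> s)\<bar> \<le> 1 * wiener_norm (\<lambda>x. \<rho> t x - \<rho> s x)"
      using wiener_norm_triangle[OF W(1) W(1) W(2), OF st(2,1,1,2)]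
        wiener_norm_triangle[OF W(1) W(1) W(2), OF st(1,2,2,1)] eq by linarith
  qed
  then have "compact ((\<lambda>t. wiener_norm (\<rho> t)) ` {0..T})"
    by (intro compact_continuous_image) auto
  then have "bounded ((\<lambda>t. wiener_norm (\<rho> t)) ` {0..T})" by (rule compact_imp_bounded)
  then obtain N where "\<forall>z\<in>(\<lambda>t. wiener_norm (\<rho> t)) ` {0..T}. norm z \<le> N"
    unfolding bounded_iff by blast
  then have N: "wiener_norm (\<rho> t) \<le> N" if "t \<in> {0..T}" for t
    using that by (auto simp: abs_le_iff)
  obtain E where E: "\<And>f v d x. \<lbrakk>f \<in> wiener; \<And>x. 0 \<le> f x; wiener_norm f \<le> N; is_potential f v;
     x \<in> {-pi..pi}; (flux \<beta> f v has_real_derivative d) (at x)\<rbrakk> \<Longrightarrow> \<bar>d\<bar> \<le> E"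
    using flux_derivative_bounded[OF \<beta>] by blast
  have dE: "\<bar>d t x\<bar> \<le> E" if "t \<in> {0..T}" "0 < t" "x \<in> {-pi..pi}" for t x
    using E[OF W(1)[OF that(1)] nonneg[OF that(1)] N[OF that(1)] v[OF that(1)] that(3) d(2)[OF that(1,2)]] .
  have ct: "continuous_on {0..T} (\<lambda>t. \<rho> t x)" for x
  proof (rule continuous_on_of_wiener_bound[OF cont k, where c = 1])
    fix s t assume "s \<in> {0..T}" "t \<in> {0..T}"
    then show "\<bar>\<rho> t x - \<rho> s x\<bar> \<le> 1 * wiener_norm (\<lambda>x. \<rho> t x - \<rho> s x)"
      using wiener_bounds(1)[OF W(2), of s t x] by simp
  qed
  \<comment> \<open>The mean value theorem uses the derivative only strictly between s and t, so s =
    0 is allowed although the equation holds only for positive times.\<close>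
  have lip': "\<bar>\<rho> t x - \<rho> s x\<bar> \<le> E * \<bar>t - s\<bar>"
    if st: "s \<in> {0..T}" "t \<in> {0..T}" "s < t" and x: "x \<in> {-pi..pi}" for s t x
  proof -
    have der: "((\<lambda>s. \<rho> s x) has_real_derivative d u x) (at u)" if "s < u" "u < t" for u
      using d(1)[of u x] that st at_within_interior[of u "{0..T}"] by simp
    obtain l z where z: "s < z" "z < t" "((\<lambda>s. \<rho> s x) has_real_derivative l) (at z)"
      "\<rho> t x - \<rho> s x = (t - s) * l"
      using MVT[OF st(3), of "\<lambda>s. \<rho> s x"] continuous_on_subset[OF ct] st der
      by (metis atLeastatMost_subset_iff real_differentiable_def atLeastAtMost_iff)
    then have "l = d z x" using der DERIV_unique by blast
    then have "\<bar>l\<bar> \<le> E" using dE[of z x] z st x by auto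
    then have "\<bar>t - s\<bar> * \<bar>l\<bar> \<le> \<bar>t - s\<bar> * E" by (intro mult_left_mono) auto
    then show ?thesis using z(4) by (simp add: abs_mult mult.commute)
  qed
  have lip: "\<bar>\<rho> t x - \<rho> s x\<bar> \<le> E * \<bar>t - s\<bar>"
    if "s \<in> {0..T}" "t \<in> {0..T}" "x \<in> {-pi..pi}" for s t x
    using lip'[of s t x] lip'[of t s x] that by (cases s t rule: linorder_cases) (auto simp: abs_minus_commute)
  define m where "m t = integral {-pi..pi} (\<rho> t)" for t
  have int: "\<rho> t integrable_on {-pi..pi}" if "t \<in> {0..T}" for t
    by (intro integrable_continuous_real continuous_on_subset[OF wienerD(2)[OF W(1)[OF that]]]) auto
  have dm: "(m has_real_derivative 0) (at t)" if t: "0 < t" "t < T" for t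
  proof -
    have tI: "t \<in> {0..T}" using t by auto
    \<comment> \<open>The limit is taken along sequences so that dominated convergence
      applies.\<close>
    have "((\<lambda>s. (m s - m t) / (s - t)) \<longlongrightarrow> 0) (at t within {0..T})"
      unfolding tendsto_at_iff_sequentially o_def
    proof (intro allI impI)
      fix X :: "nat \<Rightarrow> real" assume X: "\<forall>i. X i \<in> {0..T} - {t}" "X \<longlonglongrightarrow> t"
      have XI: "X i \<in> {0..T}" "X i \<noteq> t" for i using X(1) by auto
      have conv: "(\<lambda>i. integral {-pi..pi} (\<lambda>x. (\<rho> (X i) x - \<rho> t x) / (X i - t))) \<longlonglongrightarrow> integral {-pi..pi} (d t)"
      proof (rule dominated_convergence(2)[where h = "\<lambda>_. E"])
        show "(\<lambda>x. (\<rho> (X i) x - \<rho> t x) / (X i - t)) integrable_on {-pi..pi}" for i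
          by (intro integrable_on_divide integrable_diff int XI tI)
        show "norm ((\<rho> (X i) x - \<rho> t x) / (X i - t)) \<le> E" if "x \<in> {-pi..pi}" for i x
          using lip[OF tI XI(1) that, of i] XI(2)[of i] by (simp add: divide_le_eq)
        show "(\<lambda>i. (\<rho> (X i) x - \<rho> t x) / (X i - t)) \<longlonglongrightarrow> d t x" if "x \<in> {-pi..pi}" for x
          using d(1)[OF tI t(1), of x] X
          unfolding has_field_derivative_iff tendsto_at_iff_sequentially o_def by blast
      qed auto
      have "(d t has_integral (flux \<beta> (\<rho> t) (v t) pi - flux \<beta> (\<rho> t) (v t) (- pi))) {-pi..pi}"
        using d(2)[OF tI t(1)]
        by (intro fundamental_theorem_of_calculus)
          (auto simp: has_real_derivative_iff_has_vector_derivative has_vector_derivative_at_within)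
      then have "integral {-pi..pi} (d t) = 0"
        using flux_ends_eq[OF W(1)[OF tI] v[OF tI]] by (simp add: integral_unique)
      moreover have "integral {-pi..pi} (\<lambda>x. (\<rho> (X i) x - \<rho> t x) / (X i - t)) = (m (X i) - m t) / (X i - t)" for i
        using integral_diff[OF int[OF XI(1)] int[OF tI], of i] by (simp add: m_def)
      ultimately show "(\<lambda>i. (m (X i) - m t) / (X i - t)) \<longlonglongrightarrow> 0" using conv by (simp only:)
    qed
    then show ?thesis using t at_within_interior[of t "{0..T}"] by (simp add: has_field_derivative_iff)
  qed
  have "continuous_on {0..T} m"
  proof (rule continuous_on_of_wiener_bound[OF cont k, where c = "2 * pi"])
    fix s t assume st: "s \<in> {0..T}" "t \<in> {0..T}"
    have "m t - m s = 2 * pi * fourier_cos (\<lambda>x. \<rho> t x - \<rho> s x) 0"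
      using fourier_cos_sin_diff(1)[OF wienerD(2)[OF W(1)[OF st(2)]] wienerD(2)[OF W(1)[OF st(1)]], of 0]
      by (simp add: m_def integral_eq_fourier_cos right_diff_distrib)
    then show "\<bar>m t - m s\<bar> \<le> 2 * pi * wiener_norm (\<lambda>x. \<rho> t x - \<rho> s x)"
      using wiener_bounds(5)[OF W(2)[OF st]] by (simp add: abs_mult)
  qed
  then show ?thesis using DERIV_isconst2[OF T _ dm, of t] t by (simp add: m_def)
qed (use t in auto)

section \<open>The maximum principle\<close>

text \<open>The terms with \<beta>' and v' both carry the factor f', which is 0 at the maximum.
  Strictness comes from \<open>pi * m < \<beta> (f x0)\<close>: it gives \<beta>(M) L > M^2, while M
  (M - mean) <= M^2 since the mean is nonnegative.\<close>

lemma flux_derivative_neg_at_max: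
  assumes f: "f \<in> wiener" "\<And>x. 0 \<le> f x" "\<And>x. f x \<le> f x0" and v: "is_potential f v"
    and \<beta>: "C_on 4 {0..} \<beta>"
    and m: "integral {-pi..pi} f \<le> m" "0 < m" "m \<le> pi * f x0" "pi * m < \<beta> (f x0)"
    and d: "(flux \<beta> f v has_real_derivative d) (at x0)"
  shows "d < 0"
proof -
  obtain \<beta>' where \<beta>': "\<And>y. 0 \<le> y \<Longrightarrow> (\<beta> has_real_derivative \<beta>' y) (at y within {0..})"
    using C_on_derivative[OF \<beta>] by auto
  define f' where "f' = trig_series (\<lambda>n. real n * fourier_sin f n) (\<lambda>n. - real n * fourier_cos f n) x0"
  define L where "L = trig_series (\<lambda>n. real n * fourier_cos f n) (\<lambda>n. real n * fourier_sin f n) x0"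
  define M where "M = f x0"
  have M: "0 < M"
    using m(2,3) unfolding M_def by (metis less_le_trans pi_gt_zero zero_less_mult_pos)
  have "f' = 0" unfolding f'_def
    by (rule DERIV_local_max[OF wiener_has_real_derivative[OF f(1)], of 1]) (use f(3) in auto)
  moreover have "d = - (\<beta>' (f x0) * f' * hilbert f x0) - \<beta> (f x0) * L + f' * deriv v x0 + f x0 * (f x0 - mean f)"
    unfolding f'_def L_def by (rule DERIV_unique[OF d flux_has_real_derivative[OF f(1,2) v \<beta>']])
  ultimately have d: "d = - \<beta> M * L + M * (M - mean f)" by (simp add: M_def)
  have "M\<^sup>2 / (pi * m) \<le> L"
    unfolding L_def
    by (rule half_laplacian_ge_at_max[OF wienerD[OF f(1)] f(2)]) (use f(3) M m in \<open>auto simp: M_def\<close>)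
  moreover have "0 < M\<^sup>2 / (pi * m)" using M m by simp
  moreover have "0 < \<beta> M" using m pi_gt_zero unfolding M_def by (meson less_trans mult_pos_pos)
  ultimately have "pi * m * (M\<^sup>2 / (pi * m)) < \<beta> M * (M\<^sup>2 / (pi * m))"
    and "\<beta> M * (M\<^sup>2 / (pi * m)) \<le> \<beta> M * L"
    using mult_strict_right_mono[of "pi * m" "\<beta> M" "M\<^sup>2 / (pi * m)"]
      mult_left_mono[of "M\<^sup>2 / (pi * m)" L "\<beta> M"] m(4)[folded M_def] by simp_all
  then have "pi * m * (M\<^sup>2 / (pi * m)) < \<beta> M * L" by (rule less_le_trans)
  then have "M\<^sup>2 < \<beta> M * L" using m by simp
  moreover have "0 \<le> integral {-pi..pi} f"
    using f(2) by (intro integral_nonneg integrable_continuous_real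
        continuous_on_subset[OF wienerD(2)[OF f(1)]]) auto
  then have "0 \<le> M * mean f" using M by (simp add: mean_def)
  ultimately show ?thesis unfolding d by (simp add: power2_eq_square algebra_simps)
qed

text \<open>Near (s, y) the increment splits into a change of time at fixed position, bounded
  uniformly in the position by \<open>wiener_norm\<close>, and a change of position at the fixed
  time s.\<close>

lemma solution_jointly_continuous:
  assumes "continuous_in_Hk k I \<rho>" "2 \<le> k"
  shows "continuous_on (I \<times> UNIV) (\<lambda>(t, x). \<rho> t x)"
  unfolding continuous_on_iff
proof (intro ballI allI impI)
  fix p :: "real \<times> real" and e :: real assume p: "p \<in> I \<times> UNIV" and e: "0 < e"
  obtain s y where sy: "p = (s, y)" by fastforce
  have s: "s \<in> I" using p sy by auto
  note W = continuous_in_Hk_wiener[OF assms]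
  obtain d1 where d1: "d1 > 0" "\<And>z. \<bar>z - y\<bar> < d1 \<Longrightarrow> \<bar>\<rho> s z - \<rho> s y\<bar> < e / 2"
    using wienerD(2)[OF W(1)[OF s]] e unfolding continuous_on_iff dist_real_def by (metis UNIV_I half_gt_zero)
  have "\<forall>\<^sub>F t in at s within I. dist (wiener_norm (\<lambda>x. \<rho> t x - \<rho> s x)) 0 < e / 2"
    using tendstoD[OF W(3)[OF s], of "e / 2"] e by simp
  then obtain d2 where d2: "d2 > 0" "\<And>t. t \<in> I \<Longrightarrow> t \<noteq> s \<Longrightarrow> dist t s < d2 \<Longrightarrow>
      \<bar>wiener_norm (\<lambda>x. \<rho> t x - \<rho> s x)\<bar> < e / 2"
    unfolding eventually_at dist_real_def[of _ 0] diff_0_right by blast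
  have "\<exists>d>0. \<forall>p'\<in>I \<times> UNIV. dist p' (s, y) < d \<longrightarrow> dist (case p' of (t, x) \<Rightarrow> \<rho> t x) (\<rho> s y) < e"
  proof (intro exI[of _ "min d1 d2"] conjI ballI impI)
    fix p' assume p: "p' \<in> I \<times> (UNIV :: real set)" "dist p' (s, y) < min d1 d2"
    obtain t z where tz: "p' = (t, z)" by fastforce
    have t: "t \<in> I" using p tz by auto
    have dt: "dist t s < d2" "\<bar>z - y\<bar> < d1"
      using p(2) dist_fst_le[of p' "(s, y)"] dist_snd_le[of p' "(s, y)"] by (auto simp: tz dist_real_def)
    have "\<bar>\<rho> t z - \<rho> s z\<bar> < e / 2"
    proof (cases "t = s")
      case False
      then show ?thesis using d2(2)[OF t _ dt(1)] wiener_bounds(1)[OF W(2)[OF s t], of z] by simp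
    qed (use e in simp)
    then show "dist (case p' of (t, x) \<Rightarrow> \<rho> t x) (\<rho> s y) < e"
      using d1(2)[OF dt(2)] unfolding tz dist_real_def prod.case by linarith
  qed (use d1 d2 in auto)
  then show "\<exists>d>0. \<forall>p'\<in>I \<times> UNIV. dist p' p < d \<longrightarrow>
      dist (case p' of (t, x) \<Rightarrow> \<rho> t x) (case p of (t, x) \<Rightarrow> \<rho> t x) < e"
    by (simp add: sy)
qed

text \<open>At the first time at which \<open>\<rho>\<close> reaches the value \<open>C\<close>, it does so at a spatial maximum.\<close>
lemma solution_less_barrier:
  assumes sol: "solution_on k \<beta> \<rho>\<^sub>0 {0..T} \<rho>" and k: "2 \<le> k" and \<beta>: "C_on 4 {0..} \<beta>"
    and m: "integral {-pi..pi} \<rho>\<^sub>0 \<le> m" "0 < m" "m \<le> pi * C" "pi * m < \<beta> C"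
    and init: "\<And>x. \<rho>\<^sub>0 x < C" and t: "t \<in> {0..T}"
  shows "\<rho> t x < C"
proof (rule ccontr)
  assume "\<not> \<rho> t x < C"
  have cont: "continuous_in_Hk k {0..T} \<rho>" and nonneg: "\<And>t x. t \<in> {0..T} \<Longrightarrow> 0 \<le> \<rho> t x"
    and r0: "\<rho> 0 = \<rho>\<^sub>0" using sol t by (auto simp: solution_on_def)
  note W = continuous_in_Hk_wiener[OF cont k]
  \<comment> \<open>Restriction to one period makes the contact set compact, so a first contact time
    exists.\<close>
  define Z where "Z = ({0..T} \<times> {-pi..pi}) \<inter> {p. C \<le> (case p of (t, x) \<Rightarrow> \<rho> t x)}"
  have reduce: "\<exists>y. (s, y) \<in> Z \<and> \<rho> s y = \<rho> s z" if "s \<in> {0..T}" "C \<le> \<rho> s z" for s z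
  proof -
    have "periodic (\<rho> s)" by (rule wienerD(1)[OF W(1)[OF that(1)]])
    then obtain y where "y \<in> {-pi..pi}" "\<rho> s y = \<rho> s z" by (rule periodic_reduce)
    then have "(s, y) \<in> Z \<and> \<rho> s y = \<rho> s z" using that by (simp add: Z_def)
    then show ?thesis ..
  qed
  have "continuous_on ({0..T} \<times> {-pi..pi}) (\<lambda>(t, x). \<rho> t x)"
    by (rule continuous_on_subset[OF solution_jointly_continuous[OF cont k]]) auto
  moreover have K: "compact ({0..T} \<times> {-pi..pi})" by (intro compact_Times) auto
  ultimately have "closed (({0..T} \<times> {-pi..pi}) \<inter> (\<lambda>(t, x). \<rho> t x) -` {C..})"
    by (intro continuous_closed_preimage compact_imp_closed[OF K]) auto
  moreover have "Z = ({0..T} \<times> {-pi..pi}) \<inter> (\<lambda>(t, x). \<rho> t x) -` {C..}" by (auto simp: Z_def)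
  ultimately have "compact Z" using compact_Int_closed[OF K, of Z] by (simp add: inf.absorb2)
  then have "compact (fst ` Z)" by (intro compact_continuous_image continuous_intros)
  moreover have "fst ` Z \<noteq> {}" using reduce[OF t, of x] \<open>\<not> \<rho> t x < C\<close> by auto
  ultimately obtain s where s: "s \<in> fst ` Z" "\<And>u. u \<in> fst ` Z \<Longrightarrow> s \<le> u"
    using compact_attains_inf by metis
  obtain x0 where x0: "(s, x0) \<in> Z" using s(1) by auto
  then have sI: "s \<in> {0..T}" and ge: "C \<le> \<rho> s x0" by (auto simp: Z_def)
  have before: "\<rho> u z < C" if "u \<in> {0..T}" "u < s" for u z
  proof (rule ccontr)
    assume "\<not> \<rho> u z < C"
    then have "\<exists>y. (u, y) \<in> Z" using reduce[OF that(1), of z] by auto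
    then have "u \<in> fst ` Z" by (metis fst_conv imageI)
    then show False using s(2)[of u] that(2) by simp
  qed
  have "s \<noteq> 0" using ge init[of x0] r0 by auto
  with sI have s0: "0 < s" by simp
  \<comment> \<open>Left limits carry the strict bound before time s over to a weak bound at s;
    hence the contact point is a global maximum with value exactly C.\<close>
  have le: "\<rho> s z \<le> C" for z
  proof -
    have "((\<lambda>u. \<rho> u z) \<longlongrightarrow> \<rho> s z) (at s within {0..<s})"
    proof -
      have "continuous_on {0..T} (\<lambda>u. case (u, z) of (t, x) \<Rightarrow> \<rho> t x)"
        by (rule continuous_on_compose2[OF solution_jointly_continuous[OF cont k]])
          (auto intro!: continuous_intros)
      then have "((\<lambda>u. \<rho> u z) \<longlongrightarrow> \<rho> s z) (at s within {0..T})"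
        using sI by (simp add: continuous_on_def)
      then show ?thesis by (rule tendsto_within_subset) (use sI in auto)
    qed
    moreover have "at s within {0..<s} \<noteq> bot"
      using s0 by (simp add: at_within_eq_bot_iff)
    moreover have "\<forall>\<^sub>F u in at s within {0..<s}. \<rho> u z \<le> C"
      using sI before by (auto simp: eventually_at_filter less_imp_le)
    ultimately show ?thesis by (intro tendsto_upperbound)
  qed
  obtain v d where v: "is_potential (\<rho> s) v"
    and d: "((\<lambda>t. \<rho> t x0) has_real_derivative d) (at s within {0..T})"
      "(flux \<beta> (\<rho> s) v has_real_derivative d) (at x0)"
    using sol sI s0 unfolding solution_on_def by metis
  have eq: "\<rho> s x0 = C" using ge le[of x0] by simp
  have "integral {-pi..pi} (\<rho> s) \<le> m"
    using solution_mass_conserved[OF sol k \<beta> sI] m(1) r0 by simp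
  then have "d < 0"
    by (intro flux_derivative_neg_at_max[OF W(1)[OF sI] nonneg[OF sI] _ v \<beta> _ m(2) _ _ d(2)])
      (simp_all add: eq le m)
  \<comment> \<open>A negative time derivative at the contact point puts the density above C
    slightly earlier, against the choice of s as the first contact time.\<close>
  then obtain h where h: "h > 0" "\<And>u. u > 0 \<Longrightarrow> s - u \<in> {0..T} \<Longrightarrow> u < h \<Longrightarrow> \<rho> s x0 < \<rho> (s - u) x0"
    using has_real_derivative_neg_dec_left[OF d(1)] by blast
  define u where "u = min s h / 2"
  have "0 < u" "u < h" "s - u \<in> {0..T}" using h(1) s0 sI by (auto simp: u_def min_def)
  then have "C < \<rho> (s - u) x0" using h(2) eq by metis
  moreover have "\<rho> (s - u) x0 < C" using before[of "s - u" x0] \<open>s - u \<in> {0..T}\<close> \<open>0 < u\<close> by simp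
  ultimately show False by simp
qed

section \<open>Choice of the barrier and the bound\<close>

lemma Linf_norm_le:
  assumes "continuous_on UNIV f" "\<And>x. \<bar>f x\<bar> \<le> C"
  shows "Linf_norm f \<le> ereal C"
  unfolding Linf_norm_def
proof (rule esssup_I)
  have "f \<in> borel_measurable borel" by (rule borel_measurable_continuous_onI[OF assms(1)])
  then have "f \<in> borel_measurable (lebesgue_on {-pi..pi})"
    by (intro continuous_imp_measurable_on_sets_lebesgue continuous_on_subset[OF assms(1)]) auto
  then show "(\<lambda>x. ereal \<bar>f x\<bar>) \<in> borel_measurable (lebesgue_on {-pi..pi})" by measurable
qed (use assms(2) in auto)

theorem proposition1:
  fixes \<beta> \<rho>\<^sub>0 :: "real \<Rightarrow> real"
  assumes "C_on 4 {0..} \<beta>"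
    and "\<forall>y\<ge>0. 0 \<le> \<beta> y"
    and "filterlim \<beta> at_top at_top"
    and "\<forall>x. 0 \<le> \<rho>\<^sub>0 x"
  shows "\<exists>C::real. \<forall>(k::nat) (\<rho> :: real \<Rightarrow> real \<Rightarrow> real) (\<tau>::ereal).
           k \<ge> 2 \<longrightarrow> \<rho>\<^sub>0 \<in> Hk k \<longrightarrow>
           \<tau> = lifespan k \<beta> \<rho>\<^sub>0 \<longrightarrow>
           solution_on k \<beta> \<rho>\<^sub>0 {t. 0 \<le> t \<and> ereal t < \<tau>} \<rho> \<longrightarrow>
           (\<forall>t. 0 \<le> t \<and> ereal t < \<tau> \<longrightarrow> Linf_norm (\<rho> t) \<le> ereal C)"
proof (cases "\<exists>k\<ge>2. \<rho>\<^sub>0 \<in> Hk k")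
  case True
  then have \<rho>0: "periodic \<rho>\<^sub>0" "continuous_on UNIV \<rho>\<^sub>0" by (auto simp: Hk_def)
  obtain B where B: "\<And>x. \<bar>\<rho>\<^sub>0 x\<bar> \<le> B" "0 < B" using periodic_bounded[OF \<rho>0] by blast
  \<comment> \<open>Adding 1 keeps m positive even when \<open>\<rho>\<^sub>0\<close> vanishes
    identically.\<close>
  define m where "m = integral {-pi..pi} \<rho>\<^sub>0 + 1"
  have "0 \<le> integral {-pi..pi} \<rho>\<^sub>0"
    using assms(4) by (intro integral_nonneg integrable_continuous_real continuous_on_subset[OF \<rho>0(2)]) auto
  then have m: "0 < m" "integral {-pi..pi} \<rho>\<^sub>0 \<le> m" by (auto simp: m_def)
  \<comment> \<open>The level must beat pi m under \<beta>, lie strictly above the initial data, and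
    be at least m / pi so that the ball of radius m / C fits into a period. It is chosen before k,
    \<rho> and \<tau> are introduced.\<close>
  have "\<forall>\<^sub>F y in at_top. pi * m < \<beta> y \<and> max B (m / pi) < y"
    using assms(3) by (intro eventually_conj eventually_gt_at_top) (simp add: filterlim_at_top_dense)
  then obtain C where C: "pi * m < \<beta> C" "max B (m / pi) < C"
    using eventually_happens'[OF trivial_limit_at_top_linorder] by blast
  have mC: "m \<le> pi * C" using C(2) by (simp add: field_simps)
  show ?thesis
  proof (intro exI[of _ C] allI impI)
    fix k \<rho> \<tau> t
    assume k: "2 \<le> k" and sol: "solution_on k \<beta> \<rho>\<^sub>0 {t. 0 \<le> t \<and> ereal t < \<tau>} \<rho>"
      and t: "0 \<le> t \<and> ereal t < \<tau>"
    \<comment> \<open>The barrier argument needs a compact time interval; each t before \<tau> is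
      treated on [0, t], with the same C.\<close>
    have "{0..t} \<subseteq> {t. 0 \<le> t \<and> ereal t < \<tau>}"
      using t by (auto intro: le_less_trans[of "ereal _" "ereal t"])
    then have sol: "solution_on k \<beta> \<rho>\<^sub>0 {0..t} \<rho>" by (rule solution_on_subset[OF sol])
    have tI: "t \<in> {0..t}" using t by simp
    have lt: "\<rho> t x < C" for x
      by (rule solution_less_barrier[OF sol k assms(1) m(2,1) mC C(1) _ tI])
        (use B(1) C(2) in \<open>auto simp: abs_less_iff intro: le_less_trans[OF abs_ge_self le_less_trans[OF B(1)]]\<close>)
    have "\<rho> t \<in> Hk k" and nonneg: "\<And>x. 0 \<le> \<rho> t x"
      using sol tI unfolding solution_on_def continuous_in_Hk_def by blast+
    then have "continuous_on UNIV (\<rho> t)" by (simp add: Hk_def)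
    then show "Linf_norm (\<rho> t) \<le> ereal C"
      by (rule Linf_norm_le) (use lt nonneg in \<open>auto simp: less_imp_le\<close>)
  qed
qed auto

end
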